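(* Let $n\ge4$ and let $\gamma=\pi\circ\lambda:[0,T]\to\mathbb{R}^n$ be a non-constant normal geodesic in $\mathbb{J}^n$; write $h_i(t)=h_i(\lambda(t))$. (1) If there is no time $t$ such that $h_1(t)$ and $h_3(t)$ are both zero, then $\gamma$ is equiregular at $t\in[0,T]$ if and only if $h_1(t)\neq0$. Moreover, $\gamma$ is ample and its growth vector is $$\mathcal{G}_\gamma(t)=\begin{cases}(2,3,4,\dots,j,j+1,\dots,n)&\text{if }h_1(t)\ne0,\\(2,3,3,4,4,\dots,j,j,\dots,n)&\text{if }h_1(t)=0.\end{cases}$$ (2) If there is a point $\bar t\in[0,T]$ such that $h_1(\bar t)=h_3(\bar t)=0$, then $h_1\equiv h_3\equiv0$ along $\gamma$; in this case $\gamma$ is not ample, and it is an abnormal geodesic.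
   Context: The group $\mathbb{J}^n$. On $\mathbb{R}^n$ with coordinates $(x,y_0,\dots,y_{n-2})$ put $X_1=\partial_x$ and $X_{i+2}=\sum_{j=i}^{n-2}\frac{x^{j-i}}{(j-i)!}\partial_{y_j}$, $i=0,\dots,n-2$. Then $[X_1,X_i]=X_{i+1}$ for $i=2,\dots,n-1$ and all other brackets vanish. $\mathbb{J}^n$ is $\mathbb{R}^n$ with the Lie group structure for which $X_1,\dots,X_n$ are left-invariant, with the sub-Riemannian structure $\mathscr{D}=\mathrm{span}\{X_1,X_2\}$, $X_1,X_2$ orthonormal. Normal and abnormal geodesics. $h_i(\lambda)=\langle\lambda,X_i\rangle$ for $\lambda\in T^*\mathbb{R}^n$, $H=\frac12(h_1^2+h_2^2)$; for a function $a$ on $T^*\mathbb{R}^n$, $\vec a$ is its Hamiltonian vector field, $da=\sigma(\cdot,\vec a)$, $\sigma$ the differential of the Liouville form; $\pi:T^*\mathbb{R}^n\to\mathbb{R}^n$ is the projection. A normal geodesic is $\gamma=\pi\circ\lambda$ with $\dot\lambda=\vec H(\lambda)$. A geodesic $\gamma$ with $\dot\gamma=u_1X_1+u_2X_2$ is abnormal if there is a nowhere-zero Lipschitz curve $\eta(t)\in T^*_{\gamma(t)}\mathbb{R}^n$ with $\dot\eta=u_1\vec h_1(\eta)+u_2\vec h_2(\eta)$ and $h_1(\eta(t))=h_2(\eta(t))=0$ (a geodesic may be both normal and abnormal). Flag. For a smooth admissible curve $\gamma$ choose a horizontal vector field $\mathsf T$ with $\mathsf T|_{\gamma(t)}=\dot\gamma(t)$.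 The flag is $\mathscr{F}^i_\gamma(t)=\mathrm{span}\{\mathcal{L}^j_{\mathsf T}(X)|_{\gamma(t)}: X \text{ a horizontal vector field},\ j\le i-1\}\subset T_{\gamma(t)}\mathbb{R}^n$ (independent of $\mathsf T$), where $\mathcal L_{\mathsf T}$ is the Lie derivative, and the growth vector is $\mathcal{G}_\gamma(t)=(k_1(t),k_2(t),\dots)$ with $k_i(t)=\dim\mathscr{F}^i_\gamma(t)$, written up to the first entry equal to $n$. $\gamma$ is equiregular at $t$ if its growth vector is locally constant at $t$, and ample at $t$ if $\mathscr{F}^m_\gamma(t)=T_{\gamma(t)}\mathbb{R}^n$ for some $m$; it is ample if it is ample at every $t\in[0,T]$. In the pattern for $h_1(t)=0$, explicitly $k_1=2$, $k_{2j}=j+2$ and $k_{2j+1}=j+2$ for $j\ge1$, until the value $n$ is reached. *)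

theory Defs
  imports "HOL-Analysis.Analysis"
begin

text \<open>
  The ambient space \<open>R^n\<close> is \<open>real ^ 'n\<close> with \<open>n = CARD('n)\<close>. The linear order on \<open>'n\<close> serves only to
  number the coordinates \<open>(x, y_0, ..., y_{n-2})\<close>: \<open>x\<close> has index \<open>ix 0\<close> and \<open>y_j\<close> has index \<open>ix (j + 1)\<close>.
\<close>

definition ix :: "nat \<Rightarrow> 'n::{finite,linorder}" where
  "ix m = sorted_list_of_set (UNIV :: 'n set) ! m"

definition partial_x :: "real ^ 'n::{finite,linorder}" where
  "partial_x = axis (ix 0) 1"

definition partial_y :: "nat \<Rightarrow> real ^ 'n::{finite,linorder}" where
  "partial_y j = axis (ix (Suc j)) 1"

text \<open>\<open>frame i\<close> is the vector field \<open>X_i\<close>; it is only meant for \<open>1 \<le> i \<le> n\<close>.\<close>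

definition frame :: "nat \<Rightarrow> real ^ 'n::{finite,linorder} \<Rightarrow> real ^ 'n::_" where
  "frame i q = (if i = 1 then partial_x
     else \<Sum>j = i - 2..CARD('n) - 2. ((q $ ix 0) ^ (j - (i - 2)) / fact (j - (i - 2))) *\<^sub>R partial_y j)"

definition distribution :: "real ^ 'n::{finite,linorder} \<Rightarrow> (real ^ 'n::_) set" where
  "distribution q = span {frame 1 q, frame 2 q}"


subsection \<open>Symplectic geometry of the cotangent bundle\<close>

text \<open>
  A covector \<open>p\<close> at \<open>q\<close> is the pair \<open>(q, p)\<close>, where \<open>p\<close> consists of its components with respect to the
  coordinate differentials, so its pairing with a tangent vector \<open>v\<close> is \<open>p \<bullet> v\<close>.
\<close>

type_synonym 'n cotangent = "(real, 'n) vec \<times> (real, 'n) vec"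

definition liouville :: "'n::finite cotangent \<Rightarrow> 'n cotangent \<Rightarrow> real" where
  "liouville z v = snd z \<bullet> fst v"

text \<open>Exterior derivative of a one-form, evaluated on constant vector fields \<open>v\<close> and \<open>w\<close>.\<close>

definition exterior_derivative ::
    "('a::real_normed_vector \<Rightarrow> 'a \<Rightarrow> real) \<Rightarrow> 'a \<Rightarrow> 'a \<Rightarrow> 'a \<Rightarrow> real" where
  "exterior_derivative \<omega> z v w =
     frechet_derivative (\<lambda>z. \<omega> z w) (at z) v - frechet_derivative (\<lambda>z. \<omega> z v) (at z) w"

definition symplectic_form :: "'n::finite cotangent \<Rightarrow> 'n cotangent \<Rightarrow> 'n cotangent \<Rightarrow> real" where
  "symplectic_form = exterior_derivative liouville"

definition hamiltonian_field :: "('n::finite cotangent \<Rightarrow> real) \<Rightarrow> 'n cotangent \<Rightarrow> 'n cotangent" where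
  "hamiltonian_field a z =
     (THE v. \<forall>w. frechet_derivative a (at z) w = symplectic_form z w v)"

definition h :: "nat \<Rightarrow> 'n::{finite,linorder} cotangent \<Rightarrow> real" where
  "h i z = snd z \<bullet> frame i (fst z)"

definition Ham :: "'n::{finite,linorder} cotangent \<Rightarrow> real" where
  "Ham z = ((h 1 z)\<^sup>2 + (h 2 z)\<^sup>2) / 2"

definition normal_extremal :: "real \<Rightarrow> (real \<Rightarrow> 'n::{finite,linorder} cotangent) \<Rightarrow> bool" where
  "normal_extremal T lam \<longleftrightarrow>
     (\<forall>t\<in>{0..T}. (lam has_vector_derivative hamiltonian_field Ham (lam t)) (at t within {0..T}))"

text \<open>
  Abnormality of a curve that is already known to be a geodesic. As \<open>\<eta>\<close> is merely Lipschitz, its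
  differential equation is required almost everywhere.
\<close>

definition abnormal :: "real \<Rightarrow> (real \<Rightarrow> real ^ 'n::{finite,linorder}) \<Rightarrow> bool" where
  "abnormal T \<gamma> \<longleftrightarrow> (\<exists>(u1 :: real \<Rightarrow> real) (u2 :: real \<Rightarrow> real) (\<eta> :: real \<Rightarrow> 'n cotangent).
     (AE t in lebesgue_on {0..T}.
        (\<gamma> has_vector_derivative u1 t *\<^sub>R frame 1 (\<gamma> t) + u2 t *\<^sub>R frame 2 (\<gamma> t)) (at t within {0..T})) \<and>
     (\<exists>L. L-lipschitz_on {0..T} \<eta>) \<and>
     (\<forall>t\<in>{0..T}. fst (\<eta> t) = \<gamma> t \<and> snd (\<eta> t) \<noteq> 0) \<and>
     (AE t in lebesgue_on {0..T}.
        (\<eta> has_vector_derivative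
           u1 t *\<^sub>R hamiltonian_field (h 1) (\<eta> t) + u2 t *\<^sub>R hamiltonian_field (h 2) (\<eta> t))
          (at t within {0..T})) \<and>
     (\<forall>t\<in>{0..T}. h 1 (\<eta> t) = 0 \<and> h 2 (\<eta> t) = 0))"


subsection \<open>Flag and growth vector\<close>

fun times_differentiable :: "nat \<Rightarrow> ('a::real_normed_vector \<Rightarrow> 'b::real_normed_vector) \<Rightarrow> bool" where
  "times_differentiable 0 f \<longleftrightarrow> continuous_on UNIV f"
| "times_differentiable (Suc k) f \<longleftrightarrow>
     (\<forall>x. f differentiable (at x)) \<and>
     (\<forall>v. times_differentiable k (\<lambda>x. frechet_derivative f (at x) v))"

definition smooth :: "('a::real_normed_vector \<Rightarrow> 'b::real_normed_vector) \<Rightarrow> bool" where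
  "smooth f \<longleftrightarrow> (\<forall>k. times_differentiable k f)"

definition horizontal_field :: "(real ^ 'n::{finite,linorder} \<Rightarrow> real ^ 'n::_) \<Rightarrow> bool" where
  "horizontal_field V \<longleftrightarrow> smooth V \<and> (\<forall>q. V q \<in> distribution q)"

text \<open>The Lie derivative of \<open>W\<close> along \<open>V\<close>, that is, the Lie bracket \<open>[V, W]\<close>.\<close>

definition lie_derivative ::
    "('a::real_normed_vector \<Rightarrow> 'a) \<Rightarrow> ('a \<Rightarrow> 'a) \<Rightarrow> 'a \<Rightarrow> 'a" where
  "lie_derivative V W q =
     frechet_derivative W (at q) (V q) - frechet_derivative V (at q) (W q)"

definition tangent_extension ::
    "real \<Rightarrow> (real \<Rightarrow> real ^ 'n::{finite,linorder}) \<Rightarrow> (real ^ 'n::_ \<Rightarrow> real ^ 'n::_) \<Rightarrow> bool" where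
  "tangent_extension T \<gamma> V \<longleftrightarrow> horizontal_field V \<and>
     (\<forall>t\<in>{0..T}. (\<gamma> has_vector_derivative V (\<gamma> t)) (at t within {0..T}))"

text \<open>
  The extension of the velocity field is an unspecified choice, so a property of the flag can only be
  derived if some extension exists and every extension has it.
\<close>

definition flag :: "real \<Rightarrow> (real \<Rightarrow> real ^ 'n::{finite,linorder}) \<Rightarrow> nat \<Rightarrow> real \<Rightarrow> (real ^ 'n::_) set" where
  "flag T \<gamma> i t = (let V = (SOME V. tangent_extension T \<gamma> V) in
     span {(lie_derivative V ^^ j) X (\<gamma> t) | X j. horizontal_field X \<and> j < i})"

text \<open>The sequence \<open>k_i(t)\<close>, \<open>i \<ge> 1\<close>; the entry at \<open>0\<close> is always \<open>0\<close>.\<close>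

definition growth_vector ::
    "real \<Rightarrow> (real \<Rightarrow> real ^ 'n::{finite,linorder}) \<Rightarrow> real \<Rightarrow> nat \<Rightarrow> nat" where
  "growth_vector T \<gamma> t = (\<lambda>i. dim (flag T \<gamma> i t))"

text \<open>
  The list \<open>(k 1, k 2, ...)\<close> up to and including the first entry equal to \<open>N\<close>;
  only meant for sequences that attain \<open>N\<close>.
\<close>

definition up_to_first :: "nat \<Rightarrow> (nat \<Rightarrow> nat) \<Rightarrow> nat list" where
  "up_to_first N k = map k [1..<Suc (LEAST m. 1 \<le> m \<and> k m = N)]"

definition equiregular_at :: "real \<Rightarrow> (real \<Rightarrow> real ^ 'n::{finite,linorder}) \<Rightarrow> real \<Rightarrow> bool" where
  "equiregular_at T \<gamma> t \<longleftrightarrow>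
     (\<forall>\<^sub>F s in at t within {0..T}. growth_vector T \<gamma> s = growth_vector T \<gamma> t)"

definition ample_at :: "real \<Rightarrow> (real \<Rightarrow> real ^ 'n::{finite,linorder}) \<Rightarrow> real \<Rightarrow> bool" where
  "ample_at T \<gamma> t \<longleftrightarrow> (\<exists>m. flag T \<gamma> m t = UNIV)"

definition ample :: "real \<Rightarrow> (real \<Rightarrow> real ^ 'n::{finite,linorder}) \<Rightarrow> bool" where
  "ample T \<gamma> \<longleftrightarrow> (\<forall>t\<in>{0..T}. ample_at T \<gamma> t)"

end

theory Submission
  imports Defs
begin

text \<open>
  Write a vector field in the frame as \<open>W = \<Sum> w\<^sub>k X\<^sub>k\<close>. For a horizontal field \<open>V = v\<^sub>1 X\<^sub>1 + v\<^sub>2 X\<^sub>2\<close> and \<open>k \<ge> 3\<close> the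
  \<open>k\<close>-th coordinate of \<open>[V, W]\<close> is \<open>V w\<^sub>k + v\<^sub>1 w\<^sub>k\<^sub>-\<^sub>1\<close>, minus \<open>v\<^sub>2 w\<^sub>1\<close> if \<open>k = 3\<close>. If \<open>V\<close> extends the velocity of the
  geodesic, then \<open>v\<^sub>1 = h\<^sub>1\<close> and \<open>v\<^sub>2 = h\<^sub>2\<close> along it. Hence \<open>X\<^sub>k\<close> enters the flag with the \<open>(k - 2)\<close>-th Lie
  derivative where \<open>h\<^sub>1 \<noteq> 0\<close>. At a zero of \<open>h\<^sub>1\<close> with \<open>h\<^sub>1' = - h\<^sub>2 h\<^sub>3 \<noteq> 0\<close>, counting orders of vanishing shows
  that it enters only with the \<open>(2k - 5)\<close>-th one. If \<open>h\<^sub>1\<close> vanishes identically, \<open>X\<^sub>n\<close> never enters. The last case is forced by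
  a common zero of \<open>h\<^sub>1\<close> and \<open>h\<^sub>3\<close>, by Gronwall's inequality for the linear system \<open>h\<^sub>1' = - h\<^sub>2 h\<^sub>3\<close>,
  \<open>h\<^sub>3' = h\<^sub>4 h\<^sub>1\<close>.
\<close>

subsection \<open>Smooth maps and derivations\<close>

lemma times_differentiable_SucD: "times_differentiable (Suc k) f \<Longrightarrow> times_differentiable k f"
proof (induction k arbitrary: f)
  case 0
  then show ?case
    by (auto simp: continuous_on_eq_continuous_at differentiable_imp_continuous_within)
next
  case (Suc k)
  then show ?case by simp
qed

lemma has_derivative_frechet:
  "f differentiable (at x) \<Longrightarrow> (f has_derivative frechet_derivative f (at x)) (at x)"
  by (simp add: frechet_derivative_works)

lemma frechet_derivative_eqI:
  "(f has_derivative f') (at x) \<Longrightarrow> frechet_derivative f (at x) = f'"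
  using frechet_derivative_at by metis

lemma times_differentiable_const: "times_differentiable k (\<lambda>x. c)"
  by (induction k arbitrary: c) auto

lemma times_differentiable_add:
  "times_differentiable k f \<Longrightarrow> times_differentiable k g \<Longrightarrow> times_differentiable k (\<lambda>x. f x + g x)"
proof (induction k arbitrary: f g)
  case 0
  then show ?case by (auto intro: continuous_on_add)
next
  case (Suc k)
  then have "frechet_derivative (\<lambda>x. f x + g x) (at x)
      = (\<lambda>v. frechet_derivative f (at x) v + frechet_derivative g (at x) v)" for x
    by (intro frechet_derivative_eqI has_derivative_add has_derivative_frechet) auto
  with Suc show ?case by auto
qed

lemma times_differentiable_compose_linear:
  assumes "bounded_linear L"
  shows "times_differentiable k f \<Longrightarrow> times_differentiable k (\<lambda>x. L (f x))"
proof (induction k arbitrary: f)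
  case 0
  with assms show ?case by (auto intro: bounded_linear.continuous_on)
next
  case (Suc k)
  have der: "((\<lambda>x. L (f x)) has_derivative (\<lambda>v. L (frechet_derivative f (at x) v))) (at x)" for x
    using Suc.prems by (intro bounded_linear.has_derivative[OF assms] has_derivative_frechet) simp
  then show ?case
    using Suc by (simp add: frechet_derivative_eqI[OF der] differentiableI[OF der])
qed

text \<open>The product rule pairs each derivative with an undifferentiated factor, so the induction
  also uses that \<open>Suc k\<close>-fold differentiability implies the \<open>k\<close>-fold
  one.\<close>

lemma times_differentiable_bilinear:
  assumes "bounded_bilinear B"
  shows "times_differentiable k f \<Longrightarrow> times_differentiable k g \<Longrightarrow>
    times_differentiable k (\<lambda>x. B (f x) (g x))"
proof (induction k arbitrary: f g)
  case 0
  with assms show ?case by (auto intro: bounded_bilinear.continuous_on)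
next
  case (Suc k)
  have der: "((\<lambda>x. B (f x) (g x)) has_derivative
      (\<lambda>v. B (f x) (frechet_derivative g (at x) v) + B (frechet_derivative f (at x) v) (g x))) (at x)" for x
    using Suc.prems by (intro bounded_bilinear.FDERIV[OF assms] has_derivative_frechet) simp_all
  have "times_differentiable k f" "times_differentiable k g"
    using Suc.prems times_differentiable_SucD by blast+
  with Suc show ?case
    by (simp add: frechet_derivative_eqI[OF der] differentiableI[OF der] times_differentiable_add)
qed

lemma smooth_const [intro]: "smooth (\<lambda>x. c)"
  by (simp add: smooth_def times_differentiable_const)

lemma smooth_add [intro]: "smooth f \<Longrightarrow> smooth g \<Longrightarrow> smooth (\<lambda>x. f x + g x)"
  by (simp add: smooth_def times_differentiable_add)

lemma smooth_compose_linear: "bounded_linear L \<Longrightarrow> smooth f \<Longrightarrow> smooth (\<lambda>x. L (f x))"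
  by (simp add: smooth_def times_differentiable_compose_linear)

lemma smooth_id: "smooth (\<lambda>x. x)"
  unfolding smooth_def
proof
  fix k
  have der: "((\<lambda>x::'a. x) has_derivative (\<lambda>v. v)) (at x)" for x by simp
  show "times_differentiable k (\<lambda>x::'a. x)"
    by (cases k) (auto simp: frechet_derivative_eqI[OF der] times_differentiable_const)
qed

lemma smooth_linear: "bounded_linear L \<Longrightarrow> smooth L"
  using smooth_compose_linear[of L "\<lambda>x. x"] smooth_id by simp

lemma smooth_bilinear: "bounded_bilinear B \<Longrightarrow> smooth f \<Longrightarrow> smooth g \<Longrightarrow> smooth (\<lambda>x. B (f x) (g x))"
  by (simp add: smooth_def times_differentiable_bilinear)

lemmas smooth_mult [intro] = smooth_bilinear[OF bounded_bilinear_mult]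
lemmas smooth_scaleR [intro] = smooth_bilinear[OF bounded_bilinear_scaleR]
lemmas smooth_inner [intro] = smooth_bilinear[OF bounded_bilinear_inner]
lemmas smooth_minus [intro] = smooth_compose_linear[OF bounded_linear_minus[OF bounded_linear_ident]]

lemma smooth_diff [intro]: "smooth f \<Longrightarrow> smooth g \<Longrightarrow> smooth (\<lambda>x. f x - g x)"
  using smooth_add[of f "\<lambda>x. - g x"] smooth_minus[of g] by simp

lemma smooth_sum [intro]: "(\<And>i. i \<in> I \<Longrightarrow> smooth (f i)) \<Longrightarrow> smooth (\<lambda>x. \<Sum>i\<in>I. f i x)"
  by (induction I rule: infinite_finite_induct) auto

lemma smooth_power [intro]: "smooth f \<Longrightarrow> smooth (\<lambda>x. f x ^ m :: real)"
  by (induction m) auto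

lemma smooth_nth [intro]: "smooth (\<lambda>q::real ^ 'n::finite. q $ i)"
  by (intro smooth_linear bounded_linear_vec_nth)

lemma smooth_differentiable: "smooth f \<Longrightarrow> f differentiable (at x)"
  unfolding smooth_def by (meson times_differentiable.simps(2))

lemma smooth_has_derivative: "smooth f \<Longrightarrow> (f has_derivative frechet_derivative f (at x)) (at x)"
  by (intro has_derivative_frechet smooth_differentiable)

lemma smooth_frechet_derivative_const:
  assumes "smooth f"
  shows "smooth (\<lambda>x. frechet_derivative f (at x) v)"
  unfolding smooth_def
proof
  fix k
  have "times_differentiable (Suc k) f"
    using assms by (simp only: smooth_def)
  then show "times_differentiable k (\<lambda>x. frechet_derivative f (at x) v)"
    by simp
qed

text \<open>Smoothness is defined through derivatives in constant directions. Expanding a variable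
  direction in the finite basis gives a finite sum of such derivatives with smooth
  coefficients.\<close>

lemma smooth_frechet_derivative:
  fixes f :: "'a::euclidean_space \<Rightarrow> 'b::real_normed_vector"
  assumes f: "smooth f" and V: "smooth V"
  shows "smooth (\<lambda>x. frechet_derivative f (at x) (V x))"
proof -
  have "frechet_derivative f (at x) (V x)
      = (\<Sum>b\<in>Basis. (V x \<bullet> b) *\<^sub>R frechet_derivative f (at x) b)" for x
  proof -
    interpret bounded_linear "frechet_derivative f (at x)"
      using smooth_has_derivative[OF f] by (rule has_derivative_bounded_linear)
    have "frechet_derivative f (at x) (\<Sum>b\<in>Basis. (V x \<bullet> b) *\<^sub>R b)
      = (\<Sum>b\<in>Basis. (V x \<bullet> b) *\<^sub>R frechet_derivative f (at x) b)"
      by (simp add: sum scaleR)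
    then show ?thesis by (simp add: euclidean_representation)
  qed
  then show ?thesis
    by (simp only:) (intro smooth_sum smooth_scaleR smooth_inner smooth_const
        smooth_frechet_derivative_const f V)
qed

lemma smooth_lie_derivative:
  fixes V :: "'a::euclidean_space \<Rightarrow> 'a"
  shows "smooth V \<Longrightarrow> smooth W \<Longrightarrow> smooth (lie_derivative V W)"
  unfolding lie_derivative_def[abs_def] by (intro smooth_diff smooth_frechet_derivative)

lemma smooth_lie_derivative_funpow:
  fixes V :: "'a::euclidean_space \<Rightarrow> 'a"
  shows "smooth V \<Longrightarrow> smooth W \<Longrightarrow> smooth ((lie_derivative V ^^ j) W)"
  by (induction j) (auto intro: smooth_lie_derivative)

section \<open>Iterated derivatives along a field and orders of vanishing\<close>

definition derivation :: "('a::real_normed_vector \<Rightarrow> 'a) \<Rightarrow> ('a \<Rightarrow> real) \<Rightarrow> 'a \<Rightarrow> real" where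
  "derivation V f q = frechet_derivative f (at q) (V q)"

context
  fixes V :: "'a::euclidean_space \<Rightarrow> 'a"
  assumes V: "smooth V"
begin

lemma smooth_derivation: "smooth f \<Longrightarrow> smooth (derivation V f)"
  unfolding derivation_def[abs_def] using V by (intro smooth_frechet_derivative)

lemma smooth_derivation_funpow: "smooth f \<Longrightarrow> smooth ((derivation V ^^ r) f)"
  by (induction r) (auto intro: smooth_derivation)

lemma derivation_0: "derivation V (\<lambda>q. 0) = (\<lambda>q. 0)"
  by (auto simp: derivation_def)

lemma derivation_add:
  assumes "smooth f" "smooth g"
  shows "derivation V (\<lambda>q. f q + g q) = (\<lambda>q. derivation V f q + derivation V g q)"
proof
  fix q
  have "frechet_derivative (\<lambda>q. f q + g q) (at q)
    = (\<lambda>v. frechet_derivative f (at q) v + frechet_derivative g (at q) v)"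
    using assms by (intro frechet_derivative_eqI has_derivative_add smooth_has_derivative)
  then show "derivation V (\<lambda>q. f q + g q) q = derivation V f q + derivation V g q"
    by (simp add: derivation_def)
qed

lemma derivation_mult:
  assumes "smooth f" "smooth g"
  shows "derivation V (\<lambda>q. f q * g q) = (\<lambda>q. derivation V f q * g q + f q * derivation V g q)"
proof
  fix q
  have "frechet_derivative (\<lambda>q. f q * g q) (at q)
    = (\<lambda>v. f q * frechet_derivative g (at q) v + frechet_derivative f (at q) v * g q)"
    using assms by (intro frechet_derivative_eqI has_derivative_mult smooth_has_derivative)
  then show "derivation V (\<lambda>q. f q * g q) q = derivation V f q * g q + f q * derivation V g q"
    by (simp add: derivation_def)
qed

lemma derivation_funpow_0: "(derivation V ^^ r) (\<lambda>q. 0) = (\<lambda>q. 0)"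
  by (induction r) (auto simp: derivation_0)

lemma derivation_funpow_add:
  "smooth f \<Longrightarrow> smooth g \<Longrightarrow> (derivation V ^^ r) (\<lambda>q. f q + g q)
    = (\<lambda>q. (derivation V ^^ r) f q + (derivation V ^^ r) g q)"
  by (induction r) (auto simp: derivation_add smooth_derivation_funpow)

text \<open>Every other term of the Leibniz expansion carries one of the vanishing iterated
  derivatives of \<open>f\<close>. The induction splits off the innermost derivative, so binomial
  coefficients never appear.\<close>

lemma derivation_funpow_mult:
  assumes "smooth a" "smooth f" "\<And>j. j < r \<Longrightarrow> (derivation V ^^ j) f q = 0"
  shows "(derivation V ^^ r) (\<lambda>q. a q * f q) q = a q * (derivation V ^^ r) f q"
  using assms
proof (induction r arbitrary: a f)
  case 0
  then show ?case by simp
next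
  case (Suc r)
  have 1: "(derivation V ^^ r) (\<lambda>q. derivation V a q * f q) q
      = derivation V a q * (derivation V ^^ r) f q"
    using Suc.prems by (intro Suc.IH smooth_derivation) auto
  have 2: "(derivation V ^^ r) (\<lambda>q. a q * derivation V f q) q
      = a q * (derivation V ^^ r) (derivation V f) q"
  proof (intro Suc.IH smooth_derivation)
    show "(derivation V ^^ j) (derivation V f) q = 0" if "j < r" for j
      using Suc.prems(3)[of "Suc j"] that by (simp add: funpow_swap1)
  qed (use Suc.prems in auto)
  have "(derivation V ^^ Suc r) (\<lambda>q. a q * f q) q
      = (derivation V ^^ r) (\<lambda>q. derivation V a q * f q + a q * derivation V f q) q"
    using Suc.prems by (simp add: funpow_Suc_right derivation_mult del: funpow.simps)
  also have "\<dots> = a q * (derivation V ^^ Suc r) f q"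
    using Suc.prems 1 2
    by (subst derivation_funpow_add) (auto simp: funpow_swap1 intro!: smooth_mult smooth_derivation)
  finally show ?case .
qed

text \<open>A factor that vanishes at \<open>q\<close> raises the order of vanishing. Only the
  Leibniz terms with a single derivative on \<open>a\<close> survive: with none the factor
  \<open>a q\<close> is zero, with more too few derivatives reach \<open>f\<close>. Hence the
  coefficient \<open>Suc r\<close>.\<close>

lemma derivation_funpow_mult_Suc:
  assumes "smooth a" "smooth f" "a q = 0" "\<And>j. j < r \<Longrightarrow> (derivation V ^^ j) f q = 0"
  shows "(derivation V ^^ Suc r) (\<lambda>q. a q * f q) q
    = real (Suc r) * derivation V a q * (derivation V ^^ r) f q"
  using assms
proof (induction r arbitrary: f)
  case 0
  then show ?case by (simp add: derivation_mult)
next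
  case (Suc r)
  have 1: "(derivation V ^^ Suc r) (\<lambda>q. derivation V a q * f q) q
      = derivation V a q * (derivation V ^^ Suc r) f q"
    using Suc.prems by (intro derivation_funpow_mult smooth_derivation) auto
  have 2: "(derivation V ^^ Suc r) (\<lambda>q. a q * derivation V f q) q
      = real (Suc r) * derivation V a q * (derivation V ^^ r) (derivation V f) q"
  proof (intro Suc.IH smooth_derivation)
    show "(derivation V ^^ j) (derivation V f) q = 0" if "j < r" for j
      using Suc.prems(4)[of "Suc j"] that by (simp add: funpow_swap1)
  qed (use Suc.prems in auto)
  have "(derivation V ^^ Suc (Suc r)) (\<lambda>q. a q * f q) q
      = (derivation V ^^ Suc r) (\<lambda>q. derivation V a q * f q + a q * derivation V f q) q"
    using Suc.prems by (subst funpow_Suc_right) (simp add: derivation_mult del: funpow.simps)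
  also have "\<dots> = derivation V a q * (derivation V ^^ Suc r) f q
      + real (Suc r) * derivation V a q * (derivation V ^^ r) (derivation V f) q"
    using Suc.prems 1 2
    by (subst derivation_funpow_add) (auto simp del: funpow.simps intro!: smooth_mult smooth_derivation)
  also have "\<dots> = real (Suc (Suc r)) * derivation V a q * (derivation V ^^ Suc r) f q"
    by (simp add: funpow_swap1 algebra_simps)
  finally show ?case .
qed

end

subsection \<open>The dual coframe\<close>

text \<open>The \<open>l\<close>-th derivative of \<open>x\<^sup>j / j!\<close>.\<close>

definition dpow :: "nat \<Rightarrow> nat \<Rightarrow> real \<Rightarrow> real" where
  "dpow l j x = (if l \<le> j then x ^ (j - l) / fact (j - l) else 0)"

lemma dpow_has_derivative: "(dpow l j has_real_derivative dpow (Suc l) j x) (at x)"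
proof (cases "Suc l \<le> j")
  case True
  then obtain m where j: "j = Suc (l + m)" using le_Suc_ex[of "Suc l" j] by auto
  have "((\<lambda>x. x ^ Suc m / fact (Suc m)) has_real_derivative x ^ m / fact m) (at x)"
    by (rule derivative_eq_intros | simp add: field_simps del: power_Suc fact_Suc)+
      (simp add: field_simps)
  then show ?thesis by (simp add: dpow_def[abs_def] j Suc_diff_le)
next
  case False
  then have "dpow l j = (\<lambda>x. if l = j then 1 else 0)" by (auto simp: dpow_def)
  with False show ?thesis by (simp add: dpow_def)
qed

lemma smooth_dpow: "smooth f \<Longrightarrow> smooth (\<lambda>q. dpow l j (f q))"
  unfolding dpow_def divide_inverse by (cases "l \<le> j") (auto intro!: smooth_mult)

text \<open>This is the binomial formula for \<open>(x + - x) ^ (k - l) / fact (k - l)\<close>, read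
  off from the addition law of the exponential series. The bound \<open>k \<le> M\<close> keeps all
  nonzero terms inside the sum.\<close>

lemma dpow_dual:
  assumes "k \<le> M"
  shows "(\<Sum>j\<le>M. dpow j k (- x) * dpow l j x) = (if k = l then 1 else 0)"
proof (cases "l \<le> k")
  case True
  have "(\<Sum>j\<le>M. dpow j k (- x) * dpow l j x) = (\<Sum>j=l..k. dpow j k (- x) * dpow l j x)"
    using assms by (intro sum.mono_neutral_right) (auto simp: dpow_def)
  also have "\<dots> = (\<Sum>i\<le>k - l. dpow (i + l) k (- x) * dpow l (i + l) x)"
    using True by (intro sum.reindex_bij_witness[of _ "\<lambda>i. i + l" "\<lambda>j. j - l"]) auto
  also have "\<dots> = (\<Sum>i\<le>k - l. (x ^ i /\<^sub>R fact i) * ((- x) ^ (k - l - i) /\<^sub>R fact (k - l - i)))"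
    using True by (intro sum.cong) (auto simp: dpow_def field_simps)
  also have "\<dots> = (x + - x) ^ (k - l) /\<^sub>R fact (k - l)"
    by (rule exp_series_add_commuting[symmetric]) simp
  finally show ?thesis using True by (auto simp: power_0_left)
next
  case False
  then show ?thesis by (auto simp: dpow_def intro!: sum.neutral)
qed

text \<open>The coframe dual to \<open>X\<^sub>1, ..., X\<^sub>n\<close> for indices \<open>1 \<le> k \<le> n\<close>: replacing \<open>x\<close> by \<open>-x\<close> inverts the
  triangular matrix of the powers \<open>x\<^sup>m / m!\<close>.\<close>

definition coframe :: "nat \<Rightarrow> real ^ 'n::{finite,linorder} \<Rightarrow> real ^ 'n::_" where
  "coframe k q = (if k = 1 then partial_x
     else \<Sum>j\<le>CARD('n) - 2. dpow j (k - 2) (- (q $ ix 0)) *\<^sub>R partial_y j)"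

text \<open>For \<open>1 \<le> k \<le> CARD('n)\<close> this is the coefficient of
  \<open>frame k\<close> in the expansion of \<open>W\<close>, by the duality proved below.\<close>

definition coord :: "nat \<Rightarrow> (real ^ 'n::{finite,linorder} \<Rightarrow> real ^ 'n::_) \<Rightarrow> real ^ 'n::_ \<Rightarrow> real" where
  "coord k W q = coframe k q \<bullet> W q"

lemma ix_eq_iff:
  assumes "m < CARD('n::{finite,linorder})" "m' < CARD('n)"
  shows "(ix m :: 'n) = ix m' \<longleftrightarrow> m = m'"
  using assms by (simp add: ix_def nth_eq_iff_index_eq)

lemma frame_1: "frame 1 q = partial_x"
  by (simp add: frame_def)

lemma coframe_1: "coframe 1 q = partial_x"
  by (simp add: coframe_def)

lemma partial_x_inner: "partial_x \<bullet> w = w $ ix 0"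
  by (simp add: partial_x_def inner_axis' inner_real_def)

lemma partial_y_inner: "partial_y j \<bullet> w = w $ ix (Suc j)"
  by (simp add: partial_y_def inner_axis' inner_real_def)

lemma partial_x_nth_x [simp]: "partial_x $ ix 0 = 1"
  by (simp add: partial_x_def)

lemma coord_1: "coord 1 W q = W q $ ix 0"
  by (simp add: coord_def coframe_def partial_x_inner)

lemma frame_eq_sum:
  assumes "2 \<le> l"
  shows "frame l (q :: real ^ 'n::{finite,linorder})
    = (\<Sum>j\<le>CARD('n) - 2. dpow (l - 2) j (q $ ix 0) *\<^sub>R partial_y j)"
  using assms unfolding frame_def by (auto simp: dpow_def intro!: sum.mono_neutral_cong_left)

text \<open>The coefficients depend on x alone, and their x-derivatives are those of the next frame
  field; this is the bracket relation \<open>[X_1, X_l] = X_(l+1)\<close>. For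
  \<open>l = CARD('n)\<close> the next field is an empty sum, hence zero.\<close>

lemma frame_has_derivative:
  assumes "2 \<le> l"
  shows "(frame l has_derivative (\<lambda>u. (u $ ix 0) *\<^sub>R frame (Suc l) q))
    (at (q :: real ^ 'n::{finite,linorder}))"
proof -
  have l: "Suc l - 2 = Suc (l - 2)" "2 \<le> Suc l" using assms by auto
  have x: "((\<lambda>q::(real, 'n) vec. q $ ix 0) has_derivative (\<lambda>u. u $ ix 0)) (at q)"
    by (intro bounded_linear.has_derivative[OF bounded_linear_vec_nth] has_derivative_ident)
  have "((\<lambda>q::(real, 'n) vec. \<Sum>j\<le>CARD('n) - 2. dpow (l - 2) j (q $ ix 0) *\<^sub>R partial_y j) has_derivative
      (\<lambda>u. \<Sum>j\<le>CARD('n) - 2. ((u $ ix 0) * dpow (Suc (l - 2)) j (q $ ix 0)) *\<^sub>R partial_y j)) (at q)"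
    by (intro has_derivative_sum has_derivative_scaleR_left DERIV_compose_FDERIV[OF dpow_has_derivative] x)
  then show ?thesis
    unfolding frame_eq_sum[OF assms, abs_def] frame_eq_sum[OF l(2)] l(1) scaleR_sum_right scaleR_scaleR .
qed

text \<open>The sign comes from the argument \<open>-x\<close>. Since \<open>dpow\<close> depends
  only on the difference of its indices, one more derivative amounts to lowering \<open>k\<close>.
  The formula starts at \<open>k = 3\<close>: \<open>coframe 2\<close> is constant, whereas
  \<open>coframe 1\<close> is not zero.\<close>

lemma coframe_has_derivative:
  assumes "3 \<le> k"
  shows "(coframe k has_derivative (\<lambda>u. - (u $ ix 0) *\<^sub>R coframe (k - 1) q))
    (at (q :: real ^ 'n::{finite,linorder}))"
proof -
  have dpow_shift: "dpow j (k - 1 - 2) y = dpow (Suc j) (k - 2) y" for j y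
    using assms by (simp add: dpow_def Suc_le_eq) (auto simp: numeral_eq_Suc diff_Suc split: nat.splits)
  have x: "((\<lambda>q::(real, 'n) vec. - (q $ ix 0)) has_derivative (\<lambda>u. - (u $ ix 0))) (at q)"
    by (intro has_derivative_minus bounded_linear.has_derivative[OF bounded_linear_vec_nth] has_derivative_ident)
  have "((\<lambda>q::(real, 'n) vec. \<Sum>j\<le>CARD('n) - 2. dpow j (k - 2) (- (q $ ix 0)) *\<^sub>R partial_y j) has_derivative
      (\<lambda>u. \<Sum>j\<le>CARD('n) - 2. ((- (u $ ix 0)) * dpow (Suc j) (k - 2) (- (q $ ix 0))) *\<^sub>R partial_y j)) (at q)"
    by (intro has_derivative_sum has_derivative_scaleR_left DERIV_compose_FDERIV[OF dpow_has_derivative] x)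
  moreover have "coframe k = (\<lambda>q::(real, 'n) vec. \<Sum>j\<le>CARD('n) - 2. dpow j (k - 2) (- (q $ ix 0)) *\<^sub>R partial_y j)"
    using assms by (auto simp: coframe_def)
  moreover have "- (u $ ix 0) *\<^sub>R coframe (k - 1) q
      = (\<Sum>j\<le>CARD('n) - 2. ((- (u $ ix 0)) * dpow (Suc j) (k - 2) (- (q $ ix 0))) *\<^sub>R partial_y j)"
    for u :: "(real, 'n) vec"
  proof -
    have "k - 1 \<noteq> 1" using assms by simp
    then show ?thesis by (simp only: coframe_def if_False scaleR_sum_right scaleR_scaleR dpow_shift)
  qed
  ultimately show ?thesis by (simp only:)
qed

lemma smooth_frame:
  assumes "1 \<le> l"
  shows "smooth (frame l)"
proof (cases "l = 1")
  case True
  then show ?thesis by (simp add: frame_def[abs_def] smooth_const)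
next
  case False
  with assms have "2 \<le> l" by simp
  then show ?thesis
    unfolding frame_eq_sum[OF \<open>2 \<le> l\<close>, abs_def]
    by (intro smooth_sum smooth_scaleR smooth_dpow smooth_nth smooth_const)
qed

lemma smooth_coframe: "smooth (coframe k)"
  unfolding coframe_def[abs_def] by (cases "k = 1") (auto intro!: smooth_sum smooth_scaleR smooth_dpow)

lemma smooth_coord: "smooth W \<Longrightarrow> smooth (coord k W)"
  unfolding coord_def[abs_def] by (intro smooth_inner smooth_coframe)

lemma horizontal_field_frame: "l \<in> {1, 2} \<Longrightarrow> horizontal_field (frame l)"
  by (auto simp: horizontal_field_def smooth_frame distribution_def span_base)

section \<open>Duality of frame and coframe, and coordinates of Lie brackets\<close>

context
  assumes card_ge_4: "4 \<le> CARD('n::{finite,linorder})"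
begin

lemma partial_y_nth:
  assumes "j \<le> CARD('n) - 2" "m < CARD('n)"
  shows "(partial_y j :: (real, 'n) vec) $ ix m = (if m = Suc j then 1 else 0)"
proof -
  have "Suc j < CARD('n)" using assms card_ge_4 by linarith
  with assms(2) show ?thesis
    using ix_eq_iff[of m "Suc j", where 'n = 'n] by (auto simp: partial_y_def axis_def)
qed

lemma partial_x_inner_sum_y: "(partial_x :: (real, 'n) vec) \<bullet> (\<Sum>j\<le>CARD('n) - 2. b j *\<^sub>R partial_y j) = 0"
  using card_ge_4 by (simp add: partial_x_inner partial_y_nth)

lemma sum_y_inner_sum_y:
  "(\<Sum>j\<le>CARD('n) - 2. a j *\<^sub>R partial_y j :: (real, 'n) vec) \<bullet> (\<Sum>j\<le>CARD('n) - 2. b j *\<^sub>R partial_y j)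
    = (\<Sum>j\<le>CARD('n) - 2. a j * b j)"
proof -
  have "(partial_y i :: (real, 'n) vec) \<bullet> (\<Sum>j\<le>CARD('n) - 2. b j *\<^sub>R partial_y j) = b i"
    if "i \<le> CARD('n) - 2" for i
    using that card_ge_4 by (simp add: partial_y_inner partial_y_nth if_distrib cong: if_cong)
  then show ?thesis
    by (simp add: inner_sum_left)
qed

lemma frame_nth_x: "2 \<le> l \<Longrightarrow> (frame l q :: (real, 'n) vec) $ ix 0 = 0"
  using partial_x_inner_sum_y by (simp add: frame_eq_sum flip: partial_x_inner)

lemma coframe_inner_frame:
  assumes "k \<in> {1..CARD('n)}" "l \<in> {1..CARD('n)}"
  shows "coframe k (q :: (real, 'n) vec) \<bullet> frame l q = (if k = l then 1 else 0)"
proof (cases "k = 1 \<or> l = 1")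
  case True
  then consider "k = 1" "l = 1" | "k = 1" "2 \<le> l" | "2 \<le> k" "l = 1" using assms by force
  then show ?thesis
  proof cases
    case 1
    then show ?thesis by (simp add: coframe_1[simplified] frame_1[simplified] partial_x_inner)
  next
    case 2
    then show ?thesis by (simp add: coframe_1[simplified] frame_nth_x partial_x_inner)
  next
    case 3
    then show ?thesis
      by (subst inner_commute) (simp add: frame_1[simplified] coframe_def partial_x_inner_sum_y)
  qed
next
  case False
  then have "2 \<le> k" "2 \<le> l" using assms by auto
  then have "coframe k q \<bullet> frame l q
      = (\<Sum>j\<le>CARD('n) - 2. dpow j (k - 2) (- (q $ ix 0)) * dpow (l - 2) j (q $ ix 0))"
    by (simp add: coframe_def frame_eq_sum sum_y_inner_sum_y)
  also have "\<dots> = (if k - 2 = l - 2 then 1 else 0)"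
    using assms by (intro dpow_dual) auto
  finally show ?thesis using \<open>2 \<le> k\<close> \<open>2 \<le> l\<close> by auto
qed

lemma inj_on_frame: "inj_on (\<lambda>k. frame k (q :: (real, 'n) vec)) {1..CARD('n)}"
  by (rule inj_onI) (metis coframe_inner_frame zero_neq_one)

text \<open>A frame vector in the span of the others would be annihilated by its own dual
  covector.\<close>

lemma independent_frame: "independent ((\<lambda>k. frame k (q :: (real, 'n) vec)) ` {1..CARD('n)})"
  unfolding dependent_def
proof safe
  fix k assume k: "k \<in> {1..CARD('n)}"
    and "frame k q \<in> span ((\<lambda>k. frame k q) ` {1..CARD('n)} - {frame k q})"
  moreover have "span ((\<lambda>k. frame k q) ` {1..CARD('n)} - {frame k q}) \<subseteq> {w. coframe k q \<bullet> w = 0}"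
    using k by (intro span_minimal subspace_hyperplane) (auto simp: coframe_inner_frame)
  ultimately show False using coframe_inner_frame[OF k k, of q] by auto
qed

text \<open>Both sides are linear in \<open>w\<close> and agree on the frame by duality; being
  \<open>CARD('n)\<close> independent vectors, the frame spans.\<close>

lemma frame_expansion: "(w :: (real, 'n) vec) = (\<Sum>k=1..CARD('n). (coframe k q \<bullet> w) *\<^sub>R frame k q)"
proof -
  let ?S = "(\<lambda>k. frame k q) ` {1..CARD('n)}"
  let ?\<Phi> = "\<lambda>w. \<Sum>k=1..CARD('n). (coframe k q \<bullet> w) *\<^sub>R frame k q"
  have "card ?S = CARD('n)"
    using inj_on_frame by (subst card_image) auto
  then have "span ?S = UNIV"
    using card_ge_dim_independent[of ?S UNIV] independent_frame by auto
  moreover have "linear ?\<Phi>"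
    by (intro linearI) (auto simp: inner_add_right scaleR_left_distrib sum.distrib scaleR_sum_right)
  moreover have "?\<Phi> v = v" if "v \<in> ?S" for v
    using that by (auto simp: coframe_inner_frame if_distrib[of "\<lambda>c. c *\<^sub>R _"] cong: if_cong)
  moreover have "linear (\<lambda>v::(real, 'n) vec. v)" using linear_id by (simp add: id_def)
  ultimately have "?\<Phi> w = w"
    using linear_eq_on_span[of ?\<Phi> "\<lambda>v. v" ?S w] by blast
  then show ?thesis ..
qed

lemma dim_span_frame:
  assumes "K \<subseteq> {1..CARD('n)}"
  shows "dim (span ((\<lambda>k. frame k (q :: (real, 'n) vec)) ` K)) = card K"
proof -
  have "independent ((\<lambda>k. frame k q) ` K)"
    using independent_frame assms by (meson image_mono independent_mono)
  then show ?thesis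
    using inj_on_frame assms by (simp add: dim_eq_card_independent card_image inj_on_subset[OF inj_on_frame])
qed

lemma coord_horizontal:
  assumes "horizontal_field (V :: (real, 'n) vec \<Rightarrow> (real, 'n) vec)" "k \<in> {3..CARD('n)}"
  shows "coord k V q = 0"
proof -
  have "span {frame 1 q, frame 2 q} \<subseteq> {w. coframe k q \<bullet> w = 0}"
    using assms card_ge_4 by (intro span_minimal subspace_hyperplane) (auto simp: coframe_inner_frame)
  with assms(1) show ?thesis by (auto simp: horizontal_field_def distribution_def coord_def)
qed

lemma frechet_derivative_coord:
  assumes "smooth (W :: (real, 'n) vec \<Rightarrow> (real, 'n) vec)" "3 \<le> k"
  shows "frechet_derivative (coord k W) (at q) u
    = coframe k q \<bullet> frechet_derivative W (at q) u - (u $ ix 0) * coord (k - 1) W q"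
proof -
  have "((\<lambda>q. coframe k q \<bullet> W q) has_derivative
      (\<lambda>u. coframe k q \<bullet> frechet_derivative W (at q) u + (- (u $ ix 0) *\<^sub>R coframe (k - 1) q) \<bullet> W q)) (at q)"
    using assms by (intro has_derivative_inner coframe_has_derivative smooth_has_derivative)
  then show ?thesis
    unfolding coord_def[abs_def] by (subst frechet_derivative_eqI) auto
qed

text \<open>The derivative of \<open>V\<close> is eliminated by differentiating the identity
  \<open>coord k V = 0\<close> in the direction \<open>W\<close>. What remains of it involves only
  \<open>coord (k - 1) V\<close>, which horizontality kills unless \<open>k = 3\<close>.\<close>

lemma coord_lie_derivative:
  fixes V W :: "(real, 'n) vec \<Rightarrow> (real, 'n) vec"
  assumes V: "horizontal_field V" and W: "smooth W" and k: "k \<in> {3..CARD('n)}"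
  shows "coord k (lie_derivative V W) q = derivation V (coord k W) q
    + coord 1 V q * coord (k - 1) W q - (if k = 3 then coord 2 V q * coord 1 W q else 0)"
proof -
  have V': "smooth V" using V by (simp add: horizontal_field_def)
  have "coord k V = (\<lambda>q. 0)" using coord_horizontal[OF V k] by auto
  then have "frechet_derivative (coord k V) (at q) (W q) = 0" by simp
  then have "coframe k q \<bullet> frechet_derivative V (at q) (W q) = (W q $ ix 0) * coord (k - 1) V q"
    using frechet_derivative_coord[OF V', of k q "W q"] k by simp
  also have "\<dots> = (if k = 3 then coord 2 V q * coord 1 W q else 0)"
  proof (cases "k = 3")
    case False
    with k have "k - 1 \<in> {3..CARD('n)}" by auto
    with False show ?thesis by (simp add: coord_horizontal[OF V])
  qed (simp add: coord_1[simplified])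
  finally show ?thesis
    using frechet_derivative_coord[OF W, of k q "V q"] k
    by (simp add: coord_def[of k "lie_derivative V W"] lie_derivative_def inner_diff_right derivation_def
        coord_1[simplified])
qed

text \<open>Common core of both flag computations: \<open>m k\<close> is the number of Lie
  derivatives at which the \<open>k\<close>-th coordinate first becomes nonzero. As \<open>m\<close>
  increases strictly, a vector attaining \<open>m k\<close> has no coordinates beyond
  \<open>k\<close>, so \<open>frame k\<close> is recovered by triangular elimination from the lower
  frame vectors.\<close>

lemma span_lie_derivatives_eq:
  fixes V :: "(real, 'n) vec \<Rightarrow> (real, 'n) vec"
  assumes vanish: "\<And>X j k. horizontal_field X \<Longrightarrow> k \<in> {3..CARD('n)} \<Longrightarrow> j < m k \<Longrightarrow>
      coord k ((lie_derivative V ^^ j) X) q = 0"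
    and attain: "\<And>k. k \<in> {3..CARD('n)} \<Longrightarrow>
      \<exists>X. horizontal_field X \<and> coord k ((lie_derivative V ^^ m k) X) q \<noteq> 0"
    and mono: "\<And>k l. 3 \<le> k \<Longrightarrow> k < l \<Longrightarrow> m k < m l"
    and "0 < i"
  shows "span {(lie_derivative V ^^ j) X q | X j. horizontal_field X \<and> j < i}
    = span ((\<lambda>k. frame k q) ` {k \<in> {1..CARD('n)}. k \<le> 2 \<or> m k < i})"
    (is "span ?F = span (_ ` ?K)")
proof (unfold span_eq, intro conjI)
  have in_F: "frame k q \<in> span ?F" if "k \<in> ?K" for k
    using that
  proof (induction k rule: less_induct)
    case (less k)
    show ?case
    proof (cases "k \<le> 2")
      case True
      with less.prems have "horizontal_field (frame k :: (real, 'n) vec \<Rightarrow> _)"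
        by (intro horizontal_field_frame) auto
      then show ?thesis
        using \<open>0 < i\<close> by (intro span_base CollectI exI[of _ "frame k"] exI[of _ 0]) auto
    next
      case False
      with less.prems have k: "k \<in> {3..CARD('n)}" and mi: "m k < i" by auto
      obtain X where X: "horizontal_field X" and nz: "coord k ((lie_derivative V ^^ m k) X) q \<noteq> 0"
        using attain[OF k] by blast
      define w where "w = (lie_derivative V ^^ m k) X q"
      have "coframe l q \<bullet> w = 0" if "l \<in> {1..CARD('n)}" "k < l" for l
        using vanish[OF X, of l "m k"] mono[of k l] that k by (auto simp: coord_def w_def)
      then have "w = (\<Sum>l=1..k. (coframe l q \<bullet> w) *\<^sub>R frame l q)"
        using k by (subst frame_expansion[of w q]) (auto intro!: sum.mono_neutral_right)
      also have "{1..k} = insert k {1..<k}" using k by auto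
      finally have "w = (coframe k q \<bullet> w) *\<^sub>R frame k q + (\<Sum>l=1..<k. (coframe l q \<bullet> w) *\<^sub>R frame l q)"
        by simp
      then have "(coframe k q \<bullet> w) *\<^sub>R frame k q
          = w - (\<Sum>l=1..<k. (coframe l q \<bullet> w) *\<^sub>R frame l q)"
        by (rule eq_diff_eq[THEN iffD2, OF sym])
      moreover have "frame l q \<in> span ?F" if "l \<in> {1..<k}" for l
        using that k mi mono[of l k] by (cases "3 \<le> l"; intro less.IH) auto
      then have "(\<Sum>l=1..<k. (coframe l q \<bullet> w) *\<^sub>R frame l q) \<in> span ?F"
        by (intro span_sum span_scale) auto
      moreover have "w \<in> span ?F"
        using X mi unfolding w_def by (intro span_base) auto
      ultimately have "(coframe k q \<bullet> w) *\<^sub>R frame k q \<in> span ?F"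
        using span_diff[of w ?F "\<Sum>l=1..<k. (coframe l q \<bullet> w) *\<^sub>R frame l q"] by (simp only:)
      from span_scale[OF this, of "inverse (coframe k q \<bullet> w)"] show ?thesis
        using nz by (simp add: coord_def w_def)
    qed
  qed
  then show "(\<lambda>k. frame k q) ` ?K \<subseteq> span ?F" by blast
  show "?F \<subseteq> span ((\<lambda>k. frame k q) ` ?K)"
  proof safe
    fix X :: "(real, 'n) vec \<Rightarrow> (real, 'n) vec" and j assume X: "horizontal_field X" and j: "j < i"
    define w where "w = (lie_derivative V ^^ j) X q"
    have "(coframe k q \<bullet> w) *\<^sub>R frame k q \<in> span ((\<lambda>k. frame k q) ` ?K)" if "k \<in> {1..CARD('n)}" for k
    proof (cases "k \<in> ?K")
      case True
      then show ?thesis by (intro span_scale span_base) auto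
    next
      case False
      then have "coframe k q \<bullet> w = 0"
        using vanish[OF X, of k j] that j by (auto simp: coord_def w_def)
      then show ?thesis by (simp add: span_zero)
    qed
    then have "w \<in> span ((\<lambda>k. frame k q) ` ?K)"
      by (subst frame_expansion[of w q]) (auto intro!: span_sum)
    then show "(lie_derivative V ^^ j) X q \<in> span ((\<lambda>k. frame k q) ` ?K)" by (simp add: w_def)
  qed
qed

end

subsection \<open>Growth of the iterated Lie derivatives\<close>

context
  assumes card_ge_4: "4 \<le> CARD('n::{finite,linorder})"
begin

lemma coord_frame:
  assumes "k \<in> {1..CARD('n)}" "l \<in> {1..CARD('n)}"
  shows "coord k (frame l) = (\<lambda>q::(real, 'n) vec. if k = l then 1 else 0)"
  using coframe_inner_frame[OF card_ge_4 assms] by (auto simp: coord_def)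

lemma coord_lie_derivative_Suc:
  fixes V X :: "(real, 'n) vec \<Rightarrow> (real, 'n) vec"
  assumes "horizontal_field V" "horizontal_field X" "k \<in> {3..CARD('n)}"
  shows "coord k ((lie_derivative V ^^ Suc j) X) = (\<lambda>q. derivation V (coord k ((lie_derivative V ^^ j) X)) q
    + coord 1 V q * coord (k - 1) ((lie_derivative V ^^ j) X) q
    - (if k = 3 then coord 2 V q * coord 1 ((lie_derivative V ^^ j) X) q else 0))"
proof
  fix q
  have "smooth ((lie_derivative V ^^ j) X)"
    using assms by (intro smooth_lie_derivative_funpow) (auto simp: horizontal_field_def)
  then show "coord k ((lie_derivative V ^^ Suc j) X) q = derivation V (coord k ((lie_derivative V ^^ j) X)) q
    + coord 1 V q * coord (k - 1) ((lie_derivative V ^^ j) X) q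
    - (if k = 3 then coord 2 V q * coord 1 ((lie_derivative V ^^ j) X) q else 0)"
    using coord_lie_derivative[OF card_ge_4 assms(1) _ assms(3)] by simp
qed

text \<open>Each Lie derivative reaches at most one further frame index. The coordinates vanish as
  functions, so their derivatives along \<open>V\<close> vanish too.\<close>

lemma coord_lie_derivatives_eq_0:
  fixes V X :: "(real, 'n) vec \<Rightarrow> (real, 'n) vec"
  assumes V: "horizontal_field V" and X: "horizontal_field X"
  shows "k \<in> {3..CARD('n)} \<Longrightarrow> j < k - 2 \<Longrightarrow> coord k ((lie_derivative V ^^ j) X) = (\<lambda>q. 0)"
proof (induction j arbitrary: k)
  case 0
  then show ?case using coord_horizontal[OF card_ge_4 X] by auto
next
  case (Suc j)
  have "coord k ((lie_derivative V ^^ j) X) = (\<lambda>q. 0)"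
    "coord (k - 1) ((lie_derivative V ^^ j) X) = (\<lambda>q. 0)" "k \<noteq> 3"
    using Suc.prems by (auto intro!: Suc.IH)
  then show ?case
    by (subst coord_lie_derivative_Suc[OF V X Suc.prems(1)]) (simp add: derivation_def)
qed

text \<open>The highest coordinate reached arises only from the preceding one, multiplied by
  \<open>coord 1 V\<close>, because its own derivative term is zero.\<close>

lemma coord_lie_derivatives_frame_2:
  fixes V :: "(real, 'n) vec \<Rightarrow> (real, 'n) vec"
  assumes V: "horizontal_field V"
  shows "j + 2 \<le> CARD('n) \<Longrightarrow>
    coord (j + 2) ((lie_derivative V ^^ j) (frame 2)) = (\<lambda>q. coord 1 V q ^ j)"
proof (induction j)
  case 0
  then show ?case using coord_frame[of 2 2] by (simp del: add_2_eq_Suc')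
next
  case (Suc j)
  have X: "horizontal_field (frame 2 :: (real, 'n) vec \<Rightarrow> _)"
    by (simp add: horizontal_field_frame)
  have k: "Suc j + 2 \<in> {3..CARD('n)}" using Suc.prems by auto
  have "coord (Suc j + 2) ((lie_derivative V ^^ j) (frame 2)) = (\<lambda>q. 0)"
    using k by (intro coord_lie_derivatives_eq_0[OF V X]) auto
  moreover have "coord (Suc j + 2 - 1) ((lie_derivative V ^^ j) (frame 2)) = (\<lambda>q. coord 1 V q ^ j)"
    using Suc by simp
  \<comment> \<open>The extra term of the recursion belongs to coordinate 3, that is, to
    \<open>j = 0\<close>, where it contains the first coordinate of \<open>frame 2\<close>.\<close>
  moreover have "coord 1 ((lie_derivative V ^^ j) (frame 2)) = (\<lambda>q. 0)" if "j = 0"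
    using that card_ge_4 by (subst that) (simp only: funpow_0 coord_frame, simp add: coord_frame)
  ultimately show ?case
    by (subst coord_lie_derivative_Suc[OF V X k], cases "j = 0") (simp_all add: derivation_def del: One_nat_def)
qed

lemma dim_span_lie_derivatives_generic:
  fixes V :: "(real, 'n) vec \<Rightarrow> (real, 'n) vec"
  assumes V: "horizontal_field V" and nz: "coord 1 V q \<noteq> 0" and i: "0 < i"
  shows "dim (span {(lie_derivative V ^^ j) X q | X j. horizontal_field X \<and> j < i}) = min (i + 1) CARD('n)"
proof -
  have "span {(lie_derivative V ^^ j) X q | X j. horizontal_field X \<and> j < i}
      = span ((\<lambda>k. frame k q) ` {k \<in> {1..CARD('n)}. k \<le> 2 \<or> k - 2 < i})"
  proof (rule span_lie_derivatives_eq[OF card_ge_4])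
    fix k assume k: "k \<in> {3..CARD('n)}"
    then have "coord k ((lie_derivative V ^^ (k - 2)) (frame 2)) q = coord 1 V q ^ (k - 2)"
      using coord_lie_derivatives_frame_2[OF V, of "k - 2"] by (simp del: add_2_eq_Suc')
    then show "\<exists>X. horizontal_field X \<and> coord k ((lie_derivative V ^^ (k - 2)) X) q \<noteq> 0"
      using nz by (intro exI[of _ "frame 2"]) (simp add: horizontal_field_frame)
  qed (use i V coord_lie_derivatives_eq_0 in auto)
  also have "{k \<in> {1..CARD('n)}. k \<le> 2 \<or> k - 2 < i} = {1..min (i + 1) CARD('n)}"
    using i by auto
  finally show ?thesis
    by (simp only:) (subst dim_span_frame[OF card_ge_4], auto)
qed

text \<open>The bound on \<open>m + r\<close> says that \<open>coord k (L\<^sup>m X)\<close> vanishes at \<open>q\<close> to order at least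
  \<open>2k - 5 - m\<close> in the direction of \<open>V\<close>: a Lie derivative lowers the order by one, while the factor
  \<open>coord 1 V\<close>, which brings in the preceding coordinate, raises it by one.\<close>

lemma coord_lie_derivatives_singular_eq_0:
  fixes V X :: "(real, 'n) vec \<Rightarrow> (real, 'n) vec"
  assumes V: "horizontal_field V" and X: "horizontal_field X" and zero: "coord 1 V q = 0"
  shows "k \<in> {3..CARD('n)} \<Longrightarrow> m + r < 2 * k - 5 \<Longrightarrow>
    (derivation V ^^ r) (coord k ((lie_derivative V ^^ m) X)) q = 0"
proof (induction m arbitrary: k r)
  case 0
  then have "coord k ((lie_derivative V ^^ 0) X) = (\<lambda>q. 0)"
    by (intro coord_lie_derivatives_eq_0[OF V X]) auto
  then show ?case using V by (simp add: derivation_funpow_0 horizontal_field_def)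
next
  case (Suc m)
  define f where "f k = coord k ((lie_derivative V ^^ m) X)" for k
  have V': "smooth V" and f: "smooth (f k)" "smooth (coord 1 V)" for k
    using V X by (auto simp: f_def horizontal_field_def intro: smooth_coord smooth_lie_derivative_funpow)
  have k: "4 \<le> k" "k - 1 \<in> {3..CARD('n)}" using Suc.prems by auto
  then have "coord k ((lie_derivative V ^^ Suc m) X)
      = (\<lambda>q. derivation V (f k) q + coord 1 V q * f (k - 1) q)"
    using coord_lie_derivative_Suc[OF V X Suc.prems(1)] by (auto simp: f_def)
  then have "(derivation V ^^ r) (coord k ((lie_derivative V ^^ Suc m) X)) q
      = (derivation V ^^ Suc r) (f k) q + (derivation V ^^ r) (\<lambda>q. coord 1 V q * f (k - 1) q) q"
    using V' f by (simp add: derivation_funpow_add smooth_derivation smooth_mult funpow_swap1 del: One_nat_def)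
  also have "(derivation V ^^ Suc r) (f k) q = 0"
    unfolding f_def using Suc.prems by (intro Suc.IH) auto
  also have "(derivation V ^^ r) (\<lambda>q. coord 1 V q * f (k - 1) q) q = 0"
  proof (cases r)
    case 0
    then show ?thesis using zero by simp
  next
    case (Suc r')
    \<comment> \<open>From \<open>Suc m + Suc r' < 2 * k - 5\<close> follows
      \<open>m + r' < 2 * (k - 1) - 5\<close>: lowering \<open>k\<close> costs two, paid for by one
      Lie derivative and by the derivative spent on \<open>coord 1 V\<close>.\<close>
    have "(derivation V ^^ j) (f (k - 1)) q = 0" if "j \<le> r'" for j
      unfolding f_def using Suc.prems k that Suc by (intro Suc.IH) auto
    then show ?thesis
      unfolding Suc using zero f V' by (subst derivation_funpow_mult_Suc) auto
  qed
  finally show ?case by simp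
qed

text \<open>At total order exactly \<open>2 * k - 5\<close> both contributions of the recursion are
  nonnegative multiples of the same expression, so they cannot cancel. The weight may be zero for
  fewer than \<open>k - 2\<close> Lie derivatives and is positive from there on; at
  \<open>m = 2 * k - 5\<close> no derivation is left.\<close>

lemma coord_lie_derivatives_singular_frame_1:
  fixes V :: "(real, 'n) vec \<Rightarrow> (real, 'n) vec"
  assumes V: "horizontal_field V" and zero: "coord 1 V q = 0"
  shows "k \<in> {3..CARD('n)} \<Longrightarrow> m \<le> 2 * k - 5 \<Longrightarrow>
    \<exists>e\<ge>0. (k - 2 \<le> m \<longrightarrow> e > 0) \<and>
      (derivation V ^^ (2 * k - 5 - m)) (coord k ((lie_derivative V ^^ m) (frame 1))) q
      = e * derivation V (coord 1 V) q ^ (k - 3) * - coord 2 V q"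
proof (induction m arbitrary: k)
  case 0
  have X: "horizontal_field (frame 1 :: (real, 'n) vec \<Rightarrow> _)"
    by (simp add: horizontal_field_frame)
  have "coord k ((lie_derivative V ^^ 0) (frame 1)) = (\<lambda>q. 0)"
    using 0 by (intro coord_lie_derivatives_eq_0[OF V X]) auto
  with 0 V show ?case
    by (intro exI[of _ 0]) (simp add: derivation_funpow_0 horizontal_field_def)
next
  case (Suc m)
  define f where "f k = coord k ((lie_derivative V ^^ m) (frame 1))" for k
  have X: "horizontal_field (frame 1 :: (real, 'n) vec \<Rightarrow> _)"
    by (simp add: horizontal_field_frame)
  have V': "smooth V" and f: "smooth (f k)" "smooth (coord 1 V)" for k
    using V X by (auto simp: f_def horizontal_field_def intro: smooth_coord smooth_lie_derivative_funpow)
  show ?case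
  proof (cases "k = 3")
    case True
    with Suc.prems have m: "m = 0" by auto
    \<comment> \<open>Here the nonzero value originates: the bracket of \<open>v_2 X_2\<close> with
      \<open>X_1\<close> has third coordinate \<open>- v_2\<close>.\<close>
    have "coord 3 (frame 1) = (\<lambda>q::(real, 'n) vec. 0)" "coord 1 (frame 1) q = 1"
      using card_ge_4 by (auto simp: coord_frame simp del: One_nat_def)
    then have "coord k ((lie_derivative V ^^ Suc m) (frame 1)) q = - coord 2 V q"
      using zero
      by (subst coord_lie_derivative_Suc[OF V X Suc.prems(1)])
        (simp add: True m derivation_def del: One_nat_def funpow.simps(2))
    then show ?thesis
      by (intro exI[of _ 1]) (simp add: True m)
  next
    case False
    with Suc.prems have k: "4 \<le> k" "k - 1 \<in> {3..CARD('n)}" by auto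
    define r where "r = 2 * k - 5 - Suc m"
    have r: "2 * k - 5 - m = Suc r" using Suc.prems by (simp add: r_def)
    obtain e where e: "e \<ge> 0" "k - 2 \<le> m \<longrightarrow> e > 0"
        "(derivation V ^^ Suc r) (f k) q = e * derivation V (coord 1 V) q ^ (k - 3) * - coord 2 V q"
      using Suc.IH[of k] Suc.prems unfolding r f_def by auto
    have "coord k ((lie_derivative V ^^ Suc m) (frame 1))
        = (\<lambda>q. derivation V (f k) q + coord 1 V q * f (k - 1) q)"
      using coord_lie_derivative_Suc[OF V X Suc.prems(1)] False by (auto simp: f_def)
    then have eq: "(derivation V ^^ r) (coord k ((lie_derivative V ^^ Suc m) (frame 1))) q
        = (derivation V ^^ Suc r) (f k) q + (derivation V ^^ r) (\<lambda>q. coord 1 V q * f (k - 1) q) q"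
      using V' f by (simp add: derivation_funpow_add smooth_derivation smooth_mult funpow_swap1 del: One_nat_def)
    show ?thesis
    proof (cases r)
      case 0
      then have "(derivation V ^^ r) (\<lambda>q. coord 1 V q * f (k - 1) q) q = 0"
        using zero by simp
      \<comment> \<open>The product vanishes with \<open>coord 1 V\<close>, but here
        \<open>m = 2 * k - 6\<close>, which is at least \<open>k - 2\<close> because
        \<open>4 \<le> k\<close>.\<close>
      moreover have "e > 0" using e 0 Suc.prems k by (auto simp: r_def)
      ultimately show ?thesis
        using e eq by (intro exI[of _ e]) (simp add: r_def)
    next
      case (Suc r')
      have r': "2 * (k - 1) - 5 - m = r'" "m \<le> 2 * (k - 1) - 5"
        using Suc k by (auto simp: r_def)
      obtain e' where e': "e' \<ge> 0" "k - 1 - 2 \<le> m \<longrightarrow> e' > 0"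
          "(derivation V ^^ r') (f (k - 1)) q = e' * derivation V (coord 1 V) q ^ (k - 1 - 3) * - coord 2 V q"
        using Suc.IH[OF k(2) r'(2)] unfolding r' f_def by blast
      have "(derivation V ^^ j) (f (k - 1)) q = 0" if "j < r'" for j
        unfolding f_def using that r' k
        by (intro coord_lie_derivatives_singular_eq_0[OF V X zero]) auto
      then have "(derivation V ^^ r) (\<lambda>q. coord 1 V q * f (k - 1) q) q
          = real r * derivation V (coord 1 V) q * (derivation V ^^ r') (f (k - 1)) q"
        unfolding Suc using zero f V' by (subst derivation_funpow_mult_Suc) auto
      also have "\<dots> = real r * e' * derivation V (coord 1 V) q ^ Suc (k - 1 - 3) * - coord 2 V q"
        by (simp only: e'(3) power_Suc ac_simps)
      also have "Suc (k - 1 - 3) = k - 3" using k by simp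
      finally have "(derivation V ^^ r) (coord k ((lie_derivative V ^^ Suc m) (frame 1))) q
          = (e + real r * e') * derivation V (coord 1 V) q ^ (k - 3) * - coord 2 V q"
        by (simp only: eq e(3) distrib_right)
      moreover have "e + real r * e' \<ge> 0" using e e' by simp
      \<comment> \<open>The assumption is the positivity condition of \<open>e'\<close>, since
        \<open>k - 1 - 2 \<le> m\<close>; moreover \<open>r > 0\<close>.\<close>
      moreover have "e + real r * e' > 0" if "k - 2 \<le> Suc m"
        using that e e' Suc by (intro add_nonneg_pos) auto
      ultimately show ?thesis unfolding r_def[symmetric] by blast
    qed
  qed
qed

text \<open>\<open>frame 1\<close> attains the threshold \<open>2 * k - 5\<close>, and for
  \<open>k \<ge> 3\<close> the condition \<open>2 * k - 5 < i\<close> amounts to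
  \<open>k \<le> (i + 4) div 2\<close>.\<close>

lemma dim_span_lie_derivatives_singular:
  fixes V :: "(real, 'n) vec \<Rightarrow> (real, 'n) vec"
  assumes V: "horizontal_field V" and zero: "coord 1 V q = 0"
    and nz: "derivation V (coord 1 V) q \<noteq> 0" "coord 2 V q \<noteq> 0" and i: "0 < i"
  shows "dim (span {(lie_derivative V ^^ j) X q | X j. horizontal_field X \<and> j < i})
    = min ((i + 4) div 2) CARD('n)"
proof -
  have "span {(lie_derivative V ^^ j) X q | X j. horizontal_field X \<and> j < i}
      = span ((\<lambda>k. frame k q) ` {k \<in> {1..CARD('n)}. k \<le> 2 \<or> 2 * k - 5 < i})"
  proof (rule span_lie_derivatives_eq[OF card_ge_4])
    fix k assume k: "k \<in> {3..CARD('n)}"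
    then have "coord k ((lie_derivative V ^^ (2 * k - 5)) (frame 1)) q \<noteq> 0"
      using coord_lie_derivatives_singular_frame_1[OF V zero k order_refl] nz by auto
    then show "\<exists>X. horizontal_field X \<and> coord k ((lie_derivative V ^^ (2 * k - 5)) X) q \<noteq> 0"
      using horizontal_field_frame[of 1] by blast
  next
    fix X :: "(real, 'n) vec \<Rightarrow> (real, 'n) vec" and j k
    assume "horizontal_field X" "k \<in> {3..CARD('n)}" "j < 2 * k - 5"
    then show "coord k ((lie_derivative V ^^ j) X) q = 0"
      using coord_lie_derivatives_singular_eq_0[OF V _ zero, of X k j 0] by simp
  qed (use i in auto)
  also have "{k \<in> {1..CARD('n)}. k \<le> 2 \<or> 2 * k - 5 < i} = {1..min ((i + 4) div 2) CARD('n)}"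
    using i by auto
  finally show ?thesis
    by (simp only:) (subst dim_span_frame[OF card_ge_4], auto)
qed

end

section \<open>From dimension formulas to lists of growth numbers\<close>

lemma up_to_first_generic:
  assumes "2 \<le> N" "\<And>i. 0 < i \<Longrightarrow> g i = min (i + 1) N"
  shows "up_to_first N g = [2..<Suc N]"
proof -
  have "(LEAST m. 1 \<le> m \<and> g m = N) = N - 1"
  proof (rule Least_equality)
    show "1 \<le> N - 1 \<and> g (N - 1) = N"
      using assms(1) assms(2)[of "N - 1"] by auto
    show "N - 1 \<le> m" if "1 \<le> m \<and> g m = N" for m
      using that assms(2)[of m] by auto
  qed
  moreover have "map g [1..<N] = map Suc [1..<N]"
    using assms by (intro map_cong) auto
  ultimately show ?thesis
    using assms(1) by (simp add: up_to_first_def map_Suc_upt numeral_2_eq_2 del: upt_Suc)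
qed

lemma map_halves_upt:
  assumes "3 \<le> N"
  shows "map (\<lambda>i. (i + 4) div 2) [1..<2 * N - 4] = 2 # concat (map (\<lambda>j. [j, j]) [3..<N])"
  using assms
proof (induction N rule: dec_induct)
  case base
  then show ?case by (simp add: upt_rec)
next
  case (step N)
  then have "2 * Suc N - 4 = Suc (Suc (2 * N - 4))" "1 \<le> 2 * N - 4" by auto
  then have "[1..<2 * Suc N - 4] = [1..<2 * N - 4] @ [2 * N - 4, Suc (2 * N - 4)]"
    by simp
  moreover have "(2 * N - 4 + 4) div 2 = N" "(Suc (2 * N - 4) + 4) div 2 = N"
    using step by auto
  ultimately show ?case using step by (simp only: map_append list.map) simp
qed

text \<open>The value \<open>N\<close> is first attained at \<open>2 * N - 4\<close>, since at
  \<open>2 * N - 5\<close> the half is still \<open>N - 1\<close>. Hence the values from 3 to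
  \<open>N - 1\<close> occur twice, but \<open>N\<close> only once.\<close>

lemma up_to_first_singular:
  assumes "3 \<le> N" "\<And>i. 0 < i \<Longrightarrow> g i = min ((i + 4) div 2) N"
  shows "up_to_first N g = 2 # concat (map (\<lambda>j. [j, j]) [3..<N]) @ [N]"
proof -
  have "(LEAST m. 1 \<le> m \<and> g m = N) = 2 * N - 4"
  proof (rule Least_equality)
    show "1 \<le> 2 * N - 4 \<and> g (2 * N - 4) = N"
      using assms(1) assms(2)[of "2 * N - 4"] by auto
    show "2 * N - 4 \<le> m" if "1 \<le> m \<and> g m = N" for m
      using that assms(2)[of m] by auto
  qed
  then have "up_to_first N g = map g [1..<2 * N - 4] @ [g (2 * N - 4)]"
    using assms(1) by (simp add: up_to_first_def)
  also have "map g [1..<2 * N - 4] = map (\<lambda>i. (i + 4) div 2) [1..<2 * N - 4]"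
    using assms by (intro map_cong) auto
  also have "g (2 * N - 4) = N" using assms by auto
  finally show ?thesis by (simp only: map_halves_upt[OF assms(1)] append_Cons)
qed

subsection \<open>Normal extremals\<close>

lemma symplectic_form_eq: "symplectic_form z v w = snd v \<bullet> fst w - snd w \<bullet> fst v"
proof -
  have "frechet_derivative (\<lambda>z. liouville z w) (at z) = (\<lambda>v. snd v \<bullet> fst w)" for z w :: "'a cotangent"
    unfolding liouville_def by (intro frechet_derivative_eqI has_derivative_inner_left has_derivative_snd has_derivative_ident)
  then show ?thesis by (simp add: symplectic_form_def exterior_derivative_def)
qed

text \<open>The symplectic form is nondegenerate: testing on \<open>(0, u)\<close> and
  \<open>(u, 0)\<close> determines both components. The sign convention yields the usual Hamilton
  equations.\<close>

lemma hamiltonian_field_eqI: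
  assumes "(a has_derivative (\<lambda>w. A \<bullet> fst w + B \<bullet> snd w)) (at z)"
  shows "hamiltonian_field a z = (B, - A)"
  unfolding hamiltonian_field_def frechet_derivative_eqI[OF assms] symplectic_form_eq
proof (rule the_equality)
  show "\<forall>w. A \<bullet> fst w + B \<bullet> snd w = snd w \<bullet> fst (B, - A) - snd (B, - A) \<bullet> fst w"
    by (simp add: inner_commute)
  fix v assume v: "\<forall>w. A \<bullet> fst w + B \<bullet> snd w = snd w \<bullet> fst v - snd v \<bullet> fst w"
  have "B \<bullet> u = fst v \<bullet> u" "- A \<bullet> u = snd v \<bullet> u" for u
    using v[rule_format, of "(0, u)"] v[rule_format, of "(u, 0)"] by (auto simp: inner_commute)
  then have "B = fst v" "- A = snd v" by (meson vector_eq_rdot)+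
  then show "v = (B, - A)" by simp
qed

lemma h_has_derivative:
  assumes "2 \<le> i"
  shows "(h i has_derivative (\<lambda>w. (h (Suc i) z *\<^sub>R partial_x) \<bullet> fst w + frame i (fst z) \<bullet> snd w)) (at z)"
proof -
  have "((\<lambda>z. snd z \<bullet> frame i (fst z)) has_derivative
      (\<lambda>w. snd z \<bullet> ((fst w $ ix 0) *\<^sub>R frame (Suc i) (fst z)) + snd w \<bullet> frame i (fst z))) (at z)"
    by (intro has_derivative_inner has_derivative_snd has_derivative_ident
        has_derivative_compose[OF has_derivative_fst[OF has_derivative_ident] frame_has_derivative] assms)
  then show ?thesis
    unfolding h_def[abs_def]
    by (rule has_derivative_eq_rhs) (rule ext, simp add: partial_x_inner inner_commute)
qed

lemma h_1_has_derivative: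
  "(h 1 has_derivative (\<lambda>w. 0 \<bullet> fst w + partial_x \<bullet> snd w)) (at z)"
proof -
  have "((\<lambda>z. snd z \<bullet> partial_x) has_derivative (\<lambda>w. snd w \<bullet> partial_x)) (at z)"
    by (intro has_derivative_inner_left has_derivative_snd has_derivative_ident)
  then show ?thesis
    by (simp add: h_def[abs_def] frame_1[simplified] inner_commute)
qed

lemma hamiltonian_field_h:
  "2 \<le> i \<Longrightarrow> hamiltonian_field (h i) z = (frame i (fst z), - (h (Suc i) z) *\<^sub>R partial_x)"
  using hamiltonian_field_eqI[OF h_has_derivative] by simp

lemma hamiltonian_field_Ham:
  "hamiltonian_field Ham z = (h 1 z *\<^sub>R frame 1 (fst z) + h 2 z *\<^sub>R frame 2 (fst z),
    - (h 2 z * h 3 z) *\<^sub>R partial_x)"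
proof -
  have h2: "(h 2 has_derivative (\<lambda>w. (h 3 z *\<^sub>R partial_x) \<bullet> fst w + frame 2 (fst z) \<bullet> snd w)) (at z)"
    using h_has_derivative[of 2 z] by simp
  have "((\<lambda>z. ((h 1 z)\<^sup>2 + (h 2 z)\<^sup>2) / 2) has_derivative
    (\<lambda>w. ((h 2 z * h 3 z) *\<^sub>R partial_x) \<bullet> fst w
      + (h 1 z *\<^sub>R frame 1 (fst z) + h 2 z *\<^sub>R frame 2 (fst z)) \<bullet> snd w)) (at z)"
    by (rule derivative_eq_intros h_1_has_derivative h2 refl)+
      (auto simp: frame_1 algebra_simps simp del: One_nat_def)
  then have "(Ham has_derivative
    (\<lambda>w. ((h 2 z * h 3 z) *\<^sub>R partial_x) \<bullet> fst w
      + (h 1 z *\<^sub>R frame 1 (fst z) + h 2 z *\<^sub>R frame 2 (fst z)) \<bullet> snd w)) (at z)"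
    by (simp only: Ham_def[abs_def])
  from hamiltonian_field_eqI[OF this] show ?thesis by simp
qed

section \<open>Calculus on intervals: constancy, monotonicity and a Gronwall argument\<close>

lemma vector_derivative_0_imp_eq:
  fixes f :: "real \<Rightarrow> 'a::real_normed_vector"
  assumes "\<And>t. t \<in> {a..b} \<Longrightarrow> (f has_vector_derivative 0) (at t within {a..b})"
    and "s \<in> {a..b}" "t \<in> {a..b}"
  shows "f s = f t"
proof -
  have "\<exists>c. \<forall>t\<in>{a..b}. f t = c"
    using assms(1) by (intro has_derivative_zero_constant) (auto simp: has_vector_derivative_def)
  with assms(2,3) show ?thesis by auto
qed

lemma derivative_nonneg_imp_le:
  fixes f :: "real \<Rightarrow> real"
  assumes der: "\<And>x. x \<in> S \<Longrightarrow> (f has_real_derivative f' x) (at x within S)"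
    and nonneg: "\<And>x. x \<in> S \<Longrightarrow> 0 \<le> f' x" and "{a..b} \<subseteq> S" "a \<le> b"
  shows "f a \<le> f b"
proof (cases "a = b")
  case False
  have "\<exists>x\<in>{a<..<b}. f b - f a = f' x * (b - a)"
    using False assms
    by (intro mvt_simple) (auto simp: has_field_derivative_def[symmetric] intro!: has_field_derivative_subset[OF der])
  with assms(3,4) nonneg show ?thesis
    by (smt (verit) greaterThanLessThan_iff atLeastAtMost_iff mult_nonneg_nonneg subsetD)
qed simp

text \<open>\<open>w t * exp (- C * t)\<close> is nonincreasing and \<open>w t * exp (C * t)\<close>
  nondecreasing, so a zero spreads forwards and backwards. The factor \<open>c\<close> in
  \<open>der_exp\<close> is \<open>-1\<close> for the former and \<open>1\<close> for the
  latter.\<close>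

lemma gronwall_zero:
  fixes w :: "real \<Rightarrow> real"
  assumes der: "\<And>t. t \<in> {a..b} \<Longrightarrow> (w has_real_derivative w' t) (at t within {a..b})"
    and bound: "\<And>t. t \<in> {a..b} \<Longrightarrow> \<bar>w' t\<bar> \<le> C * w t"
    and nonneg: "\<And>t. 0 \<le> w t" and s: "s \<in> {a..b}" "w s = 0" and t: "t \<in> {a..b}"
  shows "w t = 0"
proof (rule antisym)
  have der_exp: "((\<lambda>t. c * (w t * exp (c * C * t))) has_real_derivative
      exp (c * C * t) * (c * w' t + c * c * C * w t)) (at t within {a..b})" if "t \<in> {a..b}" for c t
    by (rule derivative_eq_intros der[OF that] refl)+ (simp add: algebra_simps)
  show "w t \<le> 0"
  proof (cases "s \<le> t")
    case True
    have "-1 * (w s * exp (-1 * C * s)) \<le> -1 * (w t * exp (-1 * C * t))"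
    proof (rule derivative_nonneg_imp_le[OF der_exp])
      show "0 \<le> exp (-1 * C * x) * (-1 * w' x + -1 * -1 * C * w x)" if "x \<in> {a..b}" for x
        using bound[OF that] by auto
    qed (use s t True in auto)
    with s show ?thesis by (simp add: mult_le_0_iff)
  next
    case False
    have "1 * (w t * exp (1 * C * t)) \<le> 1 * (w s * exp (1 * C * s))"
    proof (rule derivative_nonneg_imp_le[OF der_exp])
      show "0 \<le> exp (1 * C * x) * (1 * w' x + 1 * 1 * C * w x)" if "x \<in> {a..b}" for x
        using bound[OF that] by auto
    qed (use s t False in auto)
    with s show ?thesis by (simp add: mult_le_0_iff)
  qed
qed (rule nonneg)

section \<open>A fixed normal extremal: Hamilton equations and conserved quantities\<close>

context
  fixes T :: real and \<gamma> :: "real \<Rightarrow> (real, 'n::{finite,linorder}) vec" and lam :: "real \<Rightarrow> 'n cotangent"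
  assumes card_ge_4: "4 \<le> CARD('n)" and T: "0 < T" and ext: "normal_extremal T lam"
    and \<gamma>: "\<forall>t\<in>{0..T}. \<gamma> t = fst (lam t)"
begin

lemma lam_has_vector_derivative:
  "t \<in> {0..T} \<Longrightarrow> (lam has_vector_derivative
    (h 1 (lam t) *\<^sub>R frame 1 (\<gamma> t) + h 2 (lam t) *\<^sub>R frame 2 (\<gamma> t),
     - (h 2 (lam t) * h 3 (lam t)) *\<^sub>R partial_x)) (at t within {0..T})"
  using ext \<gamma> by (simp add: normal_extremal_def hamiltonian_field_Ham)

lemma \<gamma>_has_vector_derivative:
  assumes "t \<in> {0..T}"
  shows "(\<gamma> has_vector_derivative h 1 (lam t) *\<^sub>R frame 1 (\<gamma> t) + h 2 (lam t) *\<^sub>R frame 2 (\<gamma> t))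
    (at t within {0..T})"
proof (rule has_vector_derivative_transform[OF assms])
  show "((\<lambda>t. fst (lam t)) has_vector_derivative
    h 1 (lam t) *\<^sub>R frame 1 (\<gamma> t) + h 2 (lam t) *\<^sub>R frame 2 (\<gamma> t)) (at t within {0..T})"
    using bounded_linear.has_vector_derivative[OF bounded_linear_fst lam_has_vector_derivative[OF assms]]
    by simp
qed (use \<gamma> in auto)

lemma snd_lam_has_vector_derivative:
  assumes "t \<in> {0..T}"
  shows "((\<lambda>t. snd (lam t)) has_vector_derivative - (h 2 (lam t) * h 3 (lam t)) *\<^sub>R partial_x)
    (at t within {0..T})"
  using bounded_linear.has_vector_derivative[OF bounded_linear_snd lam_has_vector_derivative[OF assms]]
  by simp

lemma h_1_lam_has_derivative:
  assumes "t \<in> {0..T}"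
  shows "((\<lambda>t. h 1 (lam t)) has_real_derivative - (h 2 (lam t) * h 3 (lam t))) (at t within {0..T})"
  using vector_derivative_diff_chain_within[OF lam_has_vector_derivative[OF assms]
      has_derivative_at_withinI[OF h_1_has_derivative]]
  by (simp add: has_real_derivative_iff_has_vector_derivative o_def partial_x_inner partial_x_nth_x
      del: One_nat_def)

text \<open>Only the motion of the base point contributes: the momentum moves along
  \<open>partial_x\<close>, to which \<open>frame i\<close> is orthogonal, while x moves at rate
  \<open>h 1\<close>.\<close>

lemma h_lam_has_derivative:
  assumes "t \<in> {0..T}" "2 \<le> i"
  shows "((\<lambda>t. h i (lam t)) has_real_derivative h 1 (lam t) * h (Suc i) (lam t)) (at t within {0..T})"
proof -
  have "frame i (fst (lam t)) \<bullet> partial_x = 0" "partial_x \<bullet> frame 2 (\<gamma> t) = 0"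
    using assms(2) by (auto simp: partial_x_inner frame_nth_x[OF card_ge_4] inner_commute[of _ partial_x])
  then show ?thesis
    using vector_derivative_diff_chain_within[OF lam_has_vector_derivative[OF assms(1)]
        has_derivative_at_withinI[OF h_has_derivative[OF assms(2)]]]
    by (simp add: has_real_derivative_iff_has_vector_derivative o_def frame_1 inner_add_right
        partial_x_inner[of partial_x] partial_x_nth_x mult.commute del: One_nat_def)
qed

lemma energy_constant:
  assumes "s \<in> {0..T}" "t \<in> {0..T}"
  shows "(h 1 (lam s))\<^sup>2 + (h 2 (lam s))\<^sup>2 = (h 1 (lam t))\<^sup>2 + (h 2 (lam t))\<^sup>2"
proof (rule vector_derivative_0_imp_eq[OF _ assms])
  fix t assume t: "t \<in> {0..T}"
  have "((\<lambda>t. (h 1 (lam t))\<^sup>2 + (h 2 (lam t))\<^sup>2) has_real_derivative 0) (at t within {0..T})"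
    by (rule derivative_eq_intros h_1_lam_has_derivative[OF t] h_lam_has_derivative[OF t] order_refl refl)+
      (simp add: eval_nat_numeral)
  then show "((\<lambda>t. (h 1 (lam t))\<^sup>2 + (h 2 (lam t))\<^sup>2) has_vector_derivative 0) (at t within {0..T})"
    by (simp only: has_real_derivative_iff_has_vector_derivative)
qed

text \<open>By conservation of energy the velocity vanishes everywhere or nowhere.\<close>

lemma h_1_h_2_nonzero:
  assumes "\<not> \<gamma> constant_on {0..T}" "t \<in> {0..T}"
  shows "h 1 (lam t) \<noteq> 0 \<or> h 2 (lam t) \<noteq> 0"
proof (rule ccontr)
  assume "\<not> ?thesis"
  then have zero: "h 1 (lam s) = 0 \<and> h 2 (lam s) = 0" if "s \<in> {0..T}" for s
    using energy_constant[OF that assms(2)] by (simp add: sum_power2_eq_zero_iff)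
  have "\<gamma> s = \<gamma> 0" if "s \<in> {0..T}" for s
  proof (rule vector_derivative_0_imp_eq[of 0 T])
    show "(\<gamma> has_vector_derivative 0) (at t within {0..T})" if "t \<in> {0..T}" for t
      using \<gamma>_has_vector_derivative[OF that] zero[OF that] by simp
  qed (use that T in auto)
  with assms(1) show False unfolding constant_on_def by blast
qed

lemma snd_lam_eq:
  assumes "t \<in> {0..T}"
  shows "snd (lam t) = snd (lam 0) + (h 1 (lam t) - h 1 (lam 0)) *\<^sub>R partial_x"
proof -
  have "snd (lam t) - h 1 (lam t) *\<^sub>R partial_x = snd (lam 0) - h 1 (lam 0) *\<^sub>R partial_x"
  proof (rule vector_derivative_0_imp_eq[of 0 T])
    fix t assume t: "t \<in> {0..T}"
    have "((\<lambda>t. h 1 (lam t) *\<^sub>R partial_x) has_vector_derivative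
        - (h 2 (lam t) * h 3 (lam t)) *\<^sub>R partial_x) (at t within {0..T})"
      using has_vector_derivative_scaleR[OF h_1_lam_has_derivative[OF t] has_vector_derivative_const, of partial_x]
      by simp
    from has_vector_derivative_diff[OF snd_lam_has_vector_derivative[OF t] this]
    show "((\<lambda>t. snd (lam t) - h 1 (lam t) *\<^sub>R partial_x) has_vector_derivative 0) (at t within {0..T})"
      by simp
  qed (use assms T in auto)
  then show ?thesis by (simp add: algebra_simps)
qed

text \<open>The y-momenta are constants of motion and \<open>frame i\<close> has no x-component.
  Thus \<open>h i\<close> becomes a function of the base point, which allows it to be extended off
  the curve.\<close>

lemma h_lam_eq:
  assumes "t \<in> {0..T}" "2 \<le> i"
  shows "h i (lam t) = snd (lam 0) \<bullet> frame i (\<gamma> t)"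
proof -
  obtain c where c: "snd (lam t) = snd (lam 0) + c *\<^sub>R partial_x"
    using snd_lam_eq[OF assms(1)] by blast
  have "fst (lam t) = \<gamma> t" using \<gamma> assms by simp
  then show ?thesis
    using assms(2) by (simp add: h_def c inner_add_left partial_x_inner frame_nth_x[OF card_ge_4])
qed

lemma frame_nth_y:
  assumes "2 \<le> l" "j \<le> CARD('n) - 2"
  shows "(frame l q :: (real, 'n) vec) $ ix (Suc j) = dpow (l - 2) j (q $ ix 0)"
proof -
  have "Suc j < CARD('n)" using assms card_ge_4 by linarith
  with assms show ?thesis
    by (simp add: frame_eq_sum partial_y_nth[OF card_ge_4] if_distrib cong: if_cong)
qed

text \<open>The y-coefficients of \<open>frame 3\<close> are those of \<open>frame 2\<close> shifted
  by one index. Shifting the y-components of \<open>p\<close> the opposite way, with zero in the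
  last place, compensates for this.\<close>

lemma ex_shifted_covector:
  "\<exists>r. \<forall>q :: (real, 'n) vec. r \<bullet> frame 1 q = 0 \<and> r \<bullet> frame 2 q = p \<bullet> frame 3 q"
proof -
  define M where "M = CARD('n) - 3"
  have M: "CARD('n) - 2 = Suc M" using card_ge_4 by (simp add: M_def)
  define r :: "(real, 'n) vec" where "r = (\<Sum>j\<le>M. (p $ ix (Suc (Suc j))) *\<^sub>R partial_y j)"
  have dpow_shift: "dpow 1 (Suc j) x = dpow 0 j x" "dpow 1 0 x = 0" for j x
    by (simp_all add: dpow_def)
  have "r \<bullet> frame 1 q = 0" for q
    using card_ge_4
    by (simp add: r_def frame_1 inner_sum_left inner_commute[of _ partial_x] partial_x_inner partial_y_nth[OF card_ge_4]
        M del: One_nat_def)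
  moreover have "r \<bullet> frame 2 q = p \<bullet> frame 3 q" for q
  proof -
    have "r \<bullet> frame 2 q = (\<Sum>j\<le>M. p $ ix (Suc (Suc j)) * dpow 0 j (q $ ix 0))"
      by (simp add: r_def inner_sum_left partial_y_inner frame_nth_y M)
    also have "\<dots> = (\<Sum>j\<le>Suc M. p $ ix (Suc j) * dpow 1 j (q $ ix 0))"
      unfolding sum.atMost_Suc_shift by (simp only: dpow_shift mult_zero_right add_0_left)
    also have "\<dots> = p \<bullet> frame 3 q"
      by (simp add: frame_eq_sum M inner_sum_right inner_commute[of p "partial_y j" for j] partial_y_inner
          mult.commute del: sum.atMost_Suc)
    finally show ?thesis .
  qed
  ultimately show ?thesis by blast
qed

text \<open>Since \<open>h\<^sub>1' = - h\<^sub>2 h\<^sub>3\<close> and \<open>h\<^sub>3 = p \<bullet> X\<^sub>3 = r \<bullet> X\<^sub>2\<close> with constant covectors \<open>p\<close> and \<open>r\<close>, the function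
  \<open>h\<^sub>1 + r \<bullet> \<gamma>\<close> is constant, so that \<open>h\<^sub>1\<close> extends to an affine function on the whole space.\<close>

lemma ex_tangent_extension: "\<exists>V. tangent_extension T \<gamma> V"
proof -
  obtain r :: "(real, 'n) vec" where r: "\<And>q. r \<bullet> frame 1 q = 0" "\<And>q. r \<bullet> frame 2 q = snd (lam 0) \<bullet> frame 3 q"
    using ex_shifted_covector by blast
  define c where "c = h 1 (lam 0) + r \<bullet> \<gamma> 0"
  define V where "V q = (c - r \<bullet> q) *\<^sub>R frame 1 q + (snd (lam 0) \<bullet> frame 2 q) *\<^sub>R frame 2 q" for q
  have "smooth V"
    unfolding V_def[abs_def]
    by (intro smooth_add smooth_scaleR smooth_diff smooth_inner smooth_const smooth_id smooth_frame) auto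
  moreover have "V q \<in> distribution q" for q
    unfolding V_def distribution_def by (intro span_add span_scale span_base) auto
  moreover have "(\<gamma> has_vector_derivative V (\<gamma> t)) (at t within {0..T})" if t: "t \<in> {0..T}" for t
  proof -
    have "h 1 (lam t) + r \<bullet> \<gamma> t = h 1 (lam 0) + r \<bullet> \<gamma> 0"
    proof (rule vector_derivative_0_imp_eq[of 0 T "\<lambda>t. h 1 (lam t) + r \<bullet> \<gamma> t"])
      fix t assume t: "t \<in> {0..T}"
      have "((\<lambda>t. r \<bullet> \<gamma> t) has_vector_derivative h 2 (lam t) * h 3 (lam t)) (at t within {0..T})"
        using bounded_linear.has_vector_derivative[OF bounded_linear_inner_right \<gamma>_has_vector_derivative[OF t], of r]
          r h_lam_eq[OF t, of 3]
        by (simp add: inner_add_right del: One_nat_def)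
      with h_1_lam_has_derivative[OF t]
      show "((\<lambda>t. h 1 (lam t) + r \<bullet> \<gamma> t) has_vector_derivative 0) (at t within {0..T})"
        unfolding has_real_derivative_iff_has_vector_derivative
        by (auto dest: has_vector_derivative_add)
    qed (use t T in auto)
    then have "c - r \<bullet> \<gamma> t = h 1 (lam t)" by (simp add: c_def)
    then have "V (\<gamma> t) = h 1 (lam t) *\<^sub>R frame 1 (\<gamma> t) + h 2 (lam t) *\<^sub>R frame 2 (\<gamma> t)"
      by (simp add: V_def h_lam_eq[OF t] del: One_nat_def)
    with \<gamma>_has_vector_derivative[OF t] show ?thesis by simp
  qed
  ultimately show ?thesis
    unfolding tangent_extension_def horizontal_field_def by blast
qed

section \<open>The flag along the geodesic, growth vectors and equiregularity\<close>

lemma flag_eq: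
  "\<exists>V. tangent_extension T \<gamma> V \<and>
    (\<forall>i t. flag T \<gamma> i t = span {(lie_derivative V ^^ j) X (\<gamma> t) | X j. horizontal_field X \<and> j < i})"
  using someI_ex[OF ex_tangent_extension]
  by (intro exI[of _ "SOME V. tangent_extension T \<gamma> V"]) (simp add: flag_def)

lemma has_derivative_along_\<gamma>:
  assumes V: "tangent_extension T \<gamma> V" and t: "t \<in> {0..T}" and f: "smooth f"
  shows "((\<lambda>t. f (\<gamma> t)) has_real_derivative derivation V f (\<gamma> t)) (at t within {0..T})"
proof -
  have "(\<gamma> has_vector_derivative V (\<gamma> t)) (at t within {0..T})"
    using V t by (simp add: tangent_extension_def)
  from vector_derivative_diff_chain_within[OF this has_derivative_at_withinI[OF smooth_has_derivative[OF f]]]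
  show ?thesis
    by (simp add: has_real_derivative_iff_has_vector_derivative o_def derivation_def)
qed

text \<open>Along the curve \<open>V\<close> is the velocity, so this derivative depends only on the
  values of \<open>f\<close> on the curve. Derivatives within the interval are unique, also at its
  endpoints, because \<open>0 < T\<close>.\<close>

lemma derivation_along_\<gamma>:
  assumes V: "tangent_extension T \<gamma> V" and t: "t \<in> {0..T}" and f: "smooth f"
    and g: "\<And>t. t \<in> {0..T} \<Longrightarrow> f (\<gamma> t) = g t" "(g has_real_derivative g') (at t within {0..T})"
  shows "derivation V f (\<gamma> t) = g'"
proof (rule vector_derivative_unique_within_closed_interval[of 0 T t])
  show "((\<lambda>t. f (\<gamma> t)) has_vector_derivative derivation V f (\<gamma> t)) (at t within cbox 0 T)"
    using has_derivative_along_\<gamma>[OF V t f] by (simp add: has_real_derivative_iff_has_vector_derivative)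
  show "((\<lambda>t. f (\<gamma> t)) has_vector_derivative g') (at t within cbox 0 T)"
    using g t by (auto simp: has_real_derivative_iff_has_vector_derivative
        intro: has_vector_derivative_transform)
qed (use T t in auto)

lemma coord_tangent_extension:
  assumes V: "tangent_extension T \<gamma> V" and t: "t \<in> {0..T}"
  shows "coord 1 V (\<gamma> t) = h 1 (lam t)" "coord 2 V (\<gamma> t) = h 2 (lam t)"
proof -
  have "V (\<gamma> t) = h 1 (lam t) *\<^sub>R frame 1 (\<gamma> t) + h 2 (lam t) *\<^sub>R frame 2 (\<gamma> t)"
  proof (rule vector_derivative_unique_within_closed_interval[of 0 T t \<gamma>])
    show "(\<gamma> has_vector_derivative V (\<gamma> t)) (at t within cbox 0 T)"
      using V t by (simp add: tangent_extension_def)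
    show "(\<gamma> has_vector_derivative h 1 (lam t) *\<^sub>R frame 1 (\<gamma> t) + h 2 (lam t) *\<^sub>R frame 2 (\<gamma> t))
        (at t within cbox 0 T)"
      using \<gamma>_has_vector_derivative[OF t] by simp
  qed (use T t in auto)
  then show "coord 1 V (\<gamma> t) = h 1 (lam t)" "coord 2 V (\<gamma> t) = h 2 (lam t)"
    using card_ge_4
    by (simp_all add: coord_def inner_add_right coframe_inner_frame[OF card_ge_4] del: One_nat_def)
qed

lemma growth_vector_generic:
  assumes t: "t \<in> {0..T}" and nz: "h 1 (lam t) \<noteq> 0"
  shows "growth_vector T \<gamma> t = (\<lambda>i. if i = 0 then 0 else min (i + 1) CARD('n))"
proof
  fix i
  obtain V where V: "tangent_extension T \<gamma> V"
    and flag: "\<And>i t. flag T \<gamma> i t = span {(lie_derivative V ^^ j) X (\<gamma> t) | X j. horizontal_field X \<and> j < i}"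
    using flag_eq by blast
  show "growth_vector T \<gamma> t i = (if i = 0 then 0 else min (i + 1) CARD('n))"
    using dim_span_lie_derivatives_generic[OF card_ge_4, of V "\<gamma> t" i] coord_tangent_extension[OF V t] nz V
    by (auto simp: growth_vector_def flag tangent_extension_def simp del: dim_span)
qed

lemma growth_vector_singular:
  assumes t: "t \<in> {0..T}" and "h 1 (lam t) = 0" "h 2 (lam t) \<noteq> 0" "h 3 (lam t) \<noteq> 0"
  shows "growth_vector T \<gamma> t = (\<lambda>i. if i = 0 then 0 else min ((i + 4) div 2) CARD('n))"
proof
  fix i
  obtain V where V: "tangent_extension T \<gamma> V"
    and flag: "\<And>i t. flag T \<gamma> i t = span {(lie_derivative V ^^ j) X (\<gamma> t) | X j. horizontal_field X \<and> j < i}"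
    using flag_eq by blast
  have "smooth (coord 1 V)"
    using V by (auto simp: tangent_extension_def horizontal_field_def intro: smooth_coord)
  \<comment> \<open>This is the time derivative of \<open>h 1\<close>; it is nonzero here, so the
    zero of \<open>h 1\<close> is simple.\<close>
  then have "derivation V (coord 1 V) (\<gamma> t) = - (h 2 (lam t) * h 3 (lam t))"
    using coord_tangent_extension(1)[OF V] h_1_lam_has_derivative[OF t]
    by (intro derivation_along_\<gamma>[OF V t, of _ "\<lambda>t. h 1 (lam t)"]) auto
  then show "growth_vector T \<gamma> t i = (if i = 0 then 0 else min ((i + 4) div 2) CARD('n))"
    using dim_span_lie_derivatives_singular[OF card_ge_4, of V "\<gamma> t" i] coord_tangent_extension[OF V t] assms V
    by (auto simp: growth_vector_def flag tangent_extension_def simp del: dim_span)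
qed

lemma ample_atI:
  assumes "growth_vector T \<gamma> t m = CARD('n)"
  shows "ample_at T \<gamma> t"
proof -
  have "span (flag T \<gamma> m t) = UNIV"
    using assms by (subst dim_eq_full[symmetric]) (simp add: growth_vector_def)
  moreover have "span (flag T \<gamma> m t) = flag T \<gamma> m t" by (simp add: flag_def Let_def)
  ultimately have "flag T \<gamma> m t = UNIV" by (simp only:)
  then show ?thesis by (auto simp: ample_at_def)
qed

lemma equiregular_at_generic:
  assumes t: "t \<in> {0..T}" and nz: "h 1 (lam t) \<noteq> 0"
  shows "equiregular_at T \<gamma> t"
proof -
  have "((\<lambda>t. h 1 (lam t)) \<longlongrightarrow> h 1 (lam t)) (at t within {0..T})"
    using DERIV_continuous[OF h_1_lam_has_derivative[OF t]] by (simp add: continuous_within)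
  from tendsto_imp_eventually_ne[OF this nz]
  have "\<forall>\<^sub>F s in at t within {0..T}. h 1 (lam s) \<noteq> 0" .
  moreover have "\<forall>\<^sub>F s in at t within {0..T}. s \<in> {0..T}"
    by (simp add: eventually_at_filter)
  ultimately show ?thesis
    unfolding equiregular_at_def
    by eventually_elim (simp add: growth_vector_generic[OF t nz] growth_vector_generic del: One_nat_def)
qed

text \<open>The difference quotient of \<open>h 1\<close> has a nonzero limit, so the zero is
  isolated and the generic growth vector holds at all nearby times.\<close>

lemma not_equiregular_at_singular:
  assumes t: "t \<in> {0..T}" and zero: "h 1 (lam t) = 0" and nz: "h 2 (lam t) \<noteq> 0" "h 3 (lam t) \<noteq> 0"
  shows "\<not> equiregular_at T \<gamma> t"
proof
  assume "equiregular_at T \<gamma> t"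
  then have "\<forall>\<^sub>F s in at t within {0..T}. growth_vector T \<gamma> s = growth_vector T \<gamma> t"
    by (simp add: equiregular_at_def)
  moreover have "((\<lambda>s. (h 1 (lam s) - h 1 (lam t)) / (s - t)) \<longlongrightarrow> - (h 2 (lam t) * h 3 (lam t))) (at t within {0..T})"
    using h_1_lam_has_derivative[OF t] by (simp add: has_field_derivative_iff)
  from tendsto_imp_eventually_ne[OF this, of 0]
  have "\<forall>\<^sub>F s in at t within {0..T}. (h 1 (lam s) - h 1 (lam t)) / (s - t) \<noteq> 0"
    using nz by simp
  moreover have "\<forall>\<^sub>F s in at t within {0..T}. s \<in> {0..T}"
    by (simp add: eventually_at_filter)
  ultimately have "\<forall>\<^sub>F s in at t within {0..T}. False"
  proof eventually_elim
    case (elim s)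
    then have "h 1 (lam s) \<noteq> 0" using zero by auto
    \<comment> \<open>The third entry is the first to differ; \<open>4 \<le> CARD('n)\<close> keeps
      the generic value 4 from being cut off.\<close>
    then have "growth_vector T \<gamma> s 3 = 4" "growth_vector T \<gamma> t 3 = 3"
      using growth_vector_generic[of s] growth_vector_singular[OF t zero nz] elim(3) card_ge_4 by auto
    then show False using elim(1) by simp
  qed
  \<comment> \<open>An eventually false statement is contradictory only if \<open>t\<close> is a
    limit point of the interval.\<close>
  moreover have "at t within {0..T} \<noteq> bot"
    using t T by (simp add: trivial_limit_within islimpt_Icc)
  ultimately show False by simp
qed

text \<open>The pair \<open>h 1\<close>, \<open>h 3\<close> solves a homogeneous linear system. Its
  squared norm \<open>w\<close> satisfies the Gronwall bound, since
  \<open>2 * \<bar>h 1 * h 3\<bar>\<close> is at most \<open>w\<close> and \<open>h 4 - h 2\<close>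
  is bounded on the compact interval.\<close>

lemma h_1_h_3_zero:
  assumes s: "s \<in> {0..T}" "h 1 (lam s) = 0" "h 3 (lam s) = 0" and t: "t \<in> {0..T}"
  shows "h 1 (lam t) = 0 \<and> h 3 (lam t) = 0"
proof -
  define w where "w t = (h 1 (lam t))\<^sup>2 + (h 3 (lam t))\<^sup>2" for t
  have der: "(w has_real_derivative 2 * (h 1 (lam t) * h 3 (lam t)) * (h 4 (lam t) - h 2 (lam t)))
      (at t within {0..T})" if t: "t \<in> {0..T}" for t
    unfolding w_def
    by (rule derivative_eq_intros h_1_lam_has_derivative[OF t] h_lam_has_derivative[OF t] refl | simp)+
      (simp add: algebra_simps eval_nat_numeral)
  have "continuous_on {0..T} (\<lambda>t. h i (lam t))" if "2 \<le> i" for i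
    using h_lam_has_derivative[OF _ that] by (intro DERIV_continuous_on) auto
  then have "continuous_on {0..T} (\<lambda>t. h 4 (lam t) - h 2 (lam t))"
    by (intro continuous_on_diff) auto
  then have "compact ((\<lambda>t. h 4 (lam t) - h 2 (lam t)) ` {0..T})"
    by (intro compact_continuous_image) auto
  then obtain C where C: "\<And>t. t \<in> {0..T} \<Longrightarrow> \<bar>h 4 (lam t) - h 2 (lam t)\<bar> \<le> C"
    by (fastforce dest!: compact_imp_bounded simp: bounded_iff)
  have "w t = 0"
  proof (rule gronwall_zero[OF der])
    fix t assume t: "t \<in> {0..T}"
    have "\<bar>2 * (h 1 (lam t) * h 3 (lam t))\<bar> \<le> w t"
      using zero_le_power2[of "\<bar>h 1 (lam t)\<bar> - \<bar>h 3 (lam t)\<bar>"]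
      by (simp add: w_def power2_diff abs_mult)
    then show "\<bar>2 * (h 1 (lam t) * h 3 (lam t)) * (h 4 (lam t) - h 2 (lam t))\<bar> \<le> C * w t"
      using C[OF t] by (subst abs_mult, subst mult.commute) (intro mult_mono, auto)
  qed (use s t in \<open>auto simp: w_def\<close>)
  then show ?thesis by (simp add: w_def sum_power2_eq_zero_iff)
qed

section \<open>Identically vanishing \<open>h 1\<close>: failure of ampleness and
  abnormality\<close>

context
  assumes h_1_zero: "\<And>t. t \<in> {0..T} \<Longrightarrow> h 1 (lam t) = 0"
begin

text \<open>The last coordinate of every iterated Lie derivative vanishes on the whole curve:
  \<open>V\<close> differentiates along the curve, and the preceding coordinate enters with the
  factor \<open>h 1\<close>. So the flag stays in the hyperplane annihilated by the last coframe
  element.\<close>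

lemma not_ample_if_h_1_zero: "\<not> ample T \<gamma>"
proof -
  obtain V where V: "tangent_extension T \<gamma> V"
    and flag: "\<And>i t. flag T \<gamma> i t = span {(lie_derivative V ^^ j) X (\<gamma> t) | X j. horizontal_field X \<and> j < i}"
    using flag_eq by blast
  have V': "horizontal_field V" using V by (simp add: tangent_extension_def)
  have N: "CARD('n) \<in> {3..CARD('n)}" "CARD('n) \<noteq> 3" using card_ge_4 by auto
  have zero: "coord CARD('n) ((lie_derivative V ^^ j) X) (\<gamma> t) = 0"
    if X: "horizontal_field X" and t: "t \<in> {0..T}" for X j t
    using t
  proof (induction j arbitrary: t)
    case 0
    then show ?case using coord_horizontal[OF card_ge_4 X N(1)] by simp
  next
    case (Suc j)
    have "smooth (coord CARD('n) ((lie_derivative V ^^ j) X))"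
      using X V' by (intro smooth_coord smooth_lie_derivative_funpow) (auto simp: horizontal_field_def)
    then have "derivation V (coord CARD('n) ((lie_derivative V ^^ j) X)) (\<gamma> t) = 0"
      using Suc by (intro derivation_along_\<gamma>[OF V, of _ _ "\<lambda>t. 0"]) auto
    moreover have "coord 1 V (\<gamma> t) = 0"
      using coord_tangent_extension[OF V Suc.prems] h_1_zero Suc.prems by simp
    ultimately show ?case
      using N by (subst coord_lie_derivative_Suc[OF card_ge_4 V' X N(1)]) (simp del: One_nat_def)
  qed
  have "flag T \<gamma> m 0 \<noteq> UNIV" for m
  proof
    assume "flag T \<gamma> m 0 = UNIV"
    moreover have "flag T \<gamma> m 0 \<subseteq> {w. coframe CARD('n) (\<gamma> 0) \<bullet> w = 0}"
      unfolding flag using zero T by (intro span_minimal subspace_hyperplane) (auto simp: coord_def)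
    ultimately have "coframe CARD('n) (\<gamma> 0) \<bullet> frame CARD('n) (\<gamma> 0) = 0" by blast
    then show False using N by (simp add: coframe_inner_frame[OF card_ge_4])
  qed
  then show ?thesis using T by (auto simp: ample_def ample_at_def intro!: bexI[of _ 0])
qed

text \<open>The first coordinate and \<open>h\<^sub>2\<close> are constant along the curve, so \<open>X\<^sub>1, X\<^sub>2, X\<^sub>3\<close> are constant as
  well, and the last coframe element annihilates them because \<open>n \<ge> 4\<close>.\<close>

lemma abnormal_if_h_1_zero: "abnormal T \<gamma>"
proof -
  have frame_const: "frame i (\<gamma> t) = frame i (\<gamma> 0)" if "t \<in> {0..T}" for t i
  proof -
    have "(\<gamma> t) $ ix 0 = (\<gamma> 0) $ ix 0"
    proof (rule vector_derivative_0_imp_eq[of 0 T "\<lambda>t. \<gamma> t $ ix 0"])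
      show "((\<lambda>t. \<gamma> t $ ix 0) has_vector_derivative 0) (at t within {0..T})" if t: "t \<in> {0..T}" for t
        using bounded_linear.has_vector_derivative[OF bounded_linear_vec_nth \<gamma>_has_vector_derivative[OF t], of "ix 0"]
          h_1_zero[OF t] by (simp add: frame_nth_x[OF card_ge_4] del: One_nat_def)
    qed (use that T in auto)
    then show ?thesis by (simp add: frame_def)
  qed
  define v where "v = h 2 (lam 0) *\<^sub>R frame 2 (\<gamma> 0)"
  have h_2: "h 2 (lam t) = h 2 (lam 0)" if "t \<in> {0..T}" for t
    using h_lam_eq[OF that] h_lam_eq[of 0] frame_const[OF that] T by simp
  have \<gamma>': "(\<gamma> has_vector_derivative v) (at t within {0..T})" if t: "t \<in> {0..T}" for t
    using \<gamma>_has_vector_derivative[OF t] h_1_zero[OF t] h_2[OF t] frame_const[OF t] by (simp add: v_def)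
  define p where "p = coframe CARD('n) (\<gamma> 0)"
  define \<eta> where "\<eta> t = (\<gamma> t, p)" for t
  have p: "p \<bullet> frame i (\<gamma> 0) = 0" if "i \<in> {1..3}" for i
    using that card_ge_4 by (simp add: p_def coframe_inner_frame)
  have "p \<bullet> frame CARD('n) (\<gamma> 0) = 1"
    using card_ge_4 by (simp add: p_def coframe_inner_frame)
  then have "p \<noteq> 0" by auto
  have h_\<eta>: "h i (\<eta> t) = 0" if "t \<in> {0..T}" "i \<in> {1..3}" for i t
    using p[OF that(2)] frame_const[OF that(1)] by (simp add: h_def \<eta>_def)
  have \<eta>': "(\<eta> has_vector_derivative (v, 0)) (at t within {0..T})" if "t \<in> {0..T}" for t
    unfolding \<eta>_def using \<gamma>'[OF that] by (intro has_vector_derivative_Pair) auto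
  have "(norm (v, 0 :: (real, 'n) vec))-lipschitz_on {0..T} \<eta>"
  proof (rule bounded_derivative_imp_lipschitz)
    show "(\<eta> has_derivative (\<lambda>x. x *\<^sub>R (v, 0))) (at t within {0..T})" if "t \<in> {0..T}" for t
      using \<eta>'[OF that] by (simp add: has_vector_derivative_def)
    show "onorm (\<lambda>x::real. x *\<^sub>R (v, 0 :: (real, 'n) vec)) \<le> norm (v, 0 :: (real, 'n) vec)" for t :: real
      by (rule onorm_le) (simp add: norm_Pair abs_mult)
  qed auto
  \<comment> \<open>The momentum part is a multiple of \<open>h 3 (\<eta> t)\<close>, which is zero
    because \<open>p\<close> annihilates \<open>frame 3\<close>; a constant momentum therefore
    solves the equation.\<close>
  moreover have "hamiltonian_field (h 2) (\<eta> t) = (frame 2 (\<gamma> 0), 0)" if "t \<in> {0..T}" for t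
    using hamiltonian_field_h[of 2 "\<eta> t"] h_\<eta>[OF that, of 3] frame_const[OF that] by (simp add: \<eta>_def)
  then have "(\<eta> has_vector_derivative
      0 *\<^sub>R hamiltonian_field (h 1) (\<eta> t) + h 2 (lam 0) *\<^sub>R hamiltonian_field (h 2) (\<eta> t)) (at t within {0..T})"
    if "t \<in> {0..T}" for t
    using \<eta>'[OF that] that by (simp add: v_def)
  moreover have "(\<gamma> has_vector_derivative 0 *\<^sub>R frame 1 (\<gamma> t) + h 2 (lam 0) *\<^sub>R frame 2 (\<gamma> t)) (at t within {0..T})"
    if "t \<in> {0..T}" for t
    using \<gamma>'[OF that] frame_const[OF that] by (simp add: v_def)
  moreover have "fst (\<eta> t) = \<gamma> t" "snd (\<eta> t) \<noteq> 0" for t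
    using \<open>p \<noteq> 0\<close> by (simp_all add: \<eta>_def)
  ultimately show ?thesis
    unfolding abnormal_def using h_\<eta>
    by (intro exI[of _ "\<lambda>_. 0"] exI[of _ "\<lambda>_. h 2 (lam 0)"] exI[of _ \<eta>]) (auto intro!: AE_I2 simp del: One_nat_def)
qed

end

end

theorem theorem4p2:
  fixes T :: real
    and \<gamma> :: "real \<Rightarrow> real ^ 'n::{finite,linorder}"
    and lam :: "real \<Rightarrow> 'n cotangent"
  assumes "CARD('n) \<ge> 4"
    and "T > 0"
    and "normal_extremal T lam"
    and "\<forall>t\<in>{0..T}. \<gamma> t = fst (lam t)"
    and "\<not> \<gamma> constant_on {0..T}"
  shows "(\<not> (\<exists>t\<in>{0..T}. h 1 (lam t) = 0 \<and> h 3 (lam t) = 0) \<longrightarrow>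
       (\<forall>t\<in>{0..T}. equiregular_at T \<gamma> t \<longleftrightarrow> h 1 (lam t) \<noteq> 0) \<and>
       ample T \<gamma> \<and>
       (\<forall>t\<in>{0..T}. up_to_first CARD('n) (growth_vector T \<gamma> t) =
          (if h 1 (lam t) \<noteq> 0 then [2..<Suc CARD('n)]
           else 2 # concat (map (\<lambda>j. [j, j]) [3..<CARD('n)]) @ [CARD('n)])))
     \<and>
     ((\<exists>s\<in>{0..T}. h 1 (lam s) = 0 \<and> h 3 (lam s) = 0) \<longrightarrow>
       (\<forall>t\<in>{0..T}. h 1 (lam t) = 0 \<and> h 3 (lam t) = 0) \<and>
       \<not> ample T \<gamma> \<and>
       abnormal T \<gamma>)"
proof (intro conjI impI)
  note extremal = assms(1-4)
  assume no_zero: "\<not> (\<exists>t\<in>{0..T}. h 1 (lam t) = 0 \<and> h 3 (lam t) = 0)"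
  \<comment> \<open>At a zero of \<open>h 1\<close>, nonconstancy of the geodesic gives the first
    claim and the absence of common zeros the second.\<close>
  have nz: "h 2 (lam t) \<noteq> 0" "h 3 (lam t) \<noteq> 0" if "t \<in> {0..T}" "h 1 (lam t) = 0" for t
    using no_zero h_1_h_2_nonzero[OF extremal assms(5) that(1)] that by auto
  show "\<forall>t\<in>{0..T}. equiregular_at T \<gamma> t \<longleftrightarrow> h 1 (lam t) \<noteq> 0"
    using equiregular_at_generic[OF extremal] not_equiregular_at_singular[OF extremal] nz by blast
  show "ample T \<gamma>"
    unfolding ample_def
  proof
    fix t assume t: "t \<in> {0..T}"
    show "ample_at T \<gamma> t"
    proof (cases "h 1 (lam t) = 0")
      case True
      then show ?thesis
        \<comment> \<open>The index \<open>2 * CARD('n)\<close> lies beyond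
          \<open>2 * CARD('n) - 4\<close>, where the full dimension is first attained.\<close>
        using assms(1)
        by (intro ample_atI[OF extremal, where m = "2 * CARD('n)"])
          (simp add: growth_vector_singular[OF extremal t True nz[OF t True]])
    next
      case False
      then show ?thesis
        using assms(1)
        by (intro ample_atI[OF extremal, where m = "CARD('n)"])
          (simp add: growth_vector_generic[OF extremal t False])
    qed
  qed
  show "\<forall>t\<in>{0..T}. up_to_first CARD('n) (growth_vector T \<gamma> t) =
      (if h 1 (lam t) \<noteq> 0 then [2..<Suc CARD('n)]
       else 2 # concat (map (\<lambda>j. [j, j]) [3..<CARD('n)]) @ [CARD('n)])"
  proof
    fix t assume t: "t \<in> {0..T}"
    show "up_to_first CARD('n) (growth_vector T \<gamma> t) =
      (if h 1 (lam t) \<noteq> 0 then [2..<Suc CARD('n)]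
       else 2 # concat (map (\<lambda>j. [j, j]) [3..<CARD('n)]) @ [CARD('n)])"
    proof (cases "h 1 (lam t) = 0")
      case True
      have "up_to_first CARD('n) (growth_vector T \<gamma> t)
          = 2 # concat (map (\<lambda>j. [j, j]) [3..<CARD('n)]) @ [CARD('n)]"
        using assms(1) growth_vector_singular[OF extremal t True nz[OF t True]]
        by (intro up_to_first_singular) auto
      with True show ?thesis by simp
    next
      case False
      have "up_to_first CARD('n) (growth_vector T \<gamma> t) = [2..<Suc CARD('n)]"
        using assms(1) growth_vector_generic[OF extremal t False]
        by (intro up_to_first_generic) auto
      with False show ?thesis by simp
    qed
  qed
next
  note extremal = assms(1-4)
  assume "\<exists>s\<in>{0..T}. h 1 (lam s) = 0 \<and> h 3 (lam s) = 0"
  then have zero: "h 1 (lam t) = 0 \<and> h 3 (lam t) = 0" if "t \<in> {0..T}" for t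
    using h_1_h_3_zero[OF extremal _ _ _ that] by blast
  then show "\<forall>t\<in>{0..T}. h 1 (lam t) = 0 \<and> h 3 (lam t) = 0" by blast
  show "\<not> ample T \<gamma>" using zero by (intro not_ample_if_h_1_zero[OF extremal]) auto
  show "abnormal T \<gamma>" using zero by (intro abnormal_if_h_1_zero[OF extremal]) auto
qed

end
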